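(* Let $\Xi=(\mathbb X,\rho,\mu^*,\{\lambda_j\},\{\phi_j\})$ be a data-defined space with exponent $q$, let $b$ be a mask of type $\beta>q/2$, and let $\mathbb G(x,y)=\sum_{j=0}^\infty b(\lambda_j)^2\phi_j(x)\phi_j(y)$. Let $R,M\ge 1$ be integers, and let each $L_k$, $k=1,\dots,R$, be a linear operator defined on $W_{2,b}$ such that point evaluations are well defined on the range of $L_k$. Let $y_\ell\in\mathbb X$, $\ell=1,\dots,M$, and $\{f_{k,\ell}\}_{k=1,\dots,R,\ \ell=1,\dots,M}\subset\mathbb C$. Assume that there exist $\phi_{k,j}\in W_{2,b}$, $k=1,\dots,R$, $j=1,\dots,M$, such that for $i=1,\dots,R$ and $\ell=1,\dots,M$, $$L_i(\phi_{k,j})(y_\ell)=\begin{cases}1,& \text{if } i=k,\ j=\ell,\\ 0,&\text{otherwise.}\end{cases}$$ Then the problem $$\text{minimize } \|g^{(b)}\|_2 \ \text{ subject to } L_k(g)(y_\ell)=f_{k,\ell},\quad k=1,\dots,R,\ \ell=1,\dots,M$$ (over $g\in W_{2,b}$) has a solution of the form $$P(x)=\sum_{k=1}^R\sum_{j=1}^M a_{k,j}\,L_{k,1}\mathbb G(y_j,x),\qquad x\in\mathbb X,$$ where $L_{k,1}\mathbb G(y_j,x)$ means that the operator $L_k$ is applied to the first variable in $\mathbb G$ and the resulting function is evaluated at $(y_j,x)$.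
   Context: Data-defined space: $\mathbb X$ is a non-empty set with a metric $\rho$; $\mu^*$ is a complete positive Borel measure with $\mu^*(\mathbb X)=1$; $0=\lambda_0\le\lambda_1\le\cdots$ with $\lambda_k\uparrow\infty$; $\{\phi_k\}_{k\ge0}$ are real-valued, continuous, bounded, integrable functions on $\mathbb X$, orthonormal with respect to $\mu^*$, with $\phi_0\equiv1$. Write $\mathbb B(x,r)=\{y\in\mathbb X:\rho(x,y)<r\}$. It is assumed that: (1) for each $x\in\mathbb X$, $r>0$, the ball $\mathbb B(x,r)$ is compact; (2) there are $q>0$, $\kappa_2>0$ with $\mu^*(\mathbb B(x,r))\le\kappa_2r^q$ for all $x\in\mathbb X$, $r>0$; (3) the series $K_t(x,y)=\sum_{k=0}^\infty \exp(-\lambda_k^2t)\phi_k(x)\phi_k(y)$ converges for all $t\in(0,1]$, $x,y\in\mathbb X$, and there are $\kappa_3,\kappa_4>0$ with $|K_t(x,y)|\le\kappa_3t^{-q/2}\exp(-\kappa_4\rho(x,y)^2/t)$ for $x,y\in\mathbb X$, $0<t\le1$. $L^p=L^p(\mu^* )$ with norm $\|\cdot\|_p$; $\hat f(k)=\int_{\mathbb X}f\phi_k\,d\mu^*$. Mask of type $\beta\in\mathbb R$: an even function $b:\mathbb R\to\mathbb R$, $S+1$ times continuously differentiable (for some fixed integer $S>q$), such that for $t>0$, $b(t)=(1+t)^{-\beta}F_b(\log t)$ for some $F_b:\mathbb R\to\mathbb R$ with $|F_b^{(k)}(t)|\le c(b)$, $t\in\mathbb R$, $k=0,\dots,S+1$,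 and $F_b(t)\ge c_1(b)$, $t\in\mathbb R$, where $c(b),c_1(b)$ are positive constants. Sobolev class: for a mask $b$, $f\in L^p$ belongs to $W_{p,b}$ if there is $f^{(b)}\in L^p$ with $b(\lambda_k)\widehat{f^{(b)}}(k)=\hat f(k)$ for all $k\ge0$; $\|f\|_{W_{p,b}}=\|f^{(b)}\|_p$. Treated as a function of either variable, $\mathbb G$ is in $W_{2,b}$.
   Formalization: Added, as the claim fails otherwise: each g ↦ L_k(g)(y_l) is bounded on W_{2,b} (a discontinuous functional has no minimizer) and is real for real-valued g (ĝ(1)+iĝ(2) with λ_1=λ_2 is a counterexample). Compactness is asked only of closures of balls. *)

theory Defs
  imports "HOL-Analysis.Analysis"
begin

text \<open>
  The metric space \<open>\<bbbX>\<close> is the whole type \<open>'a\<close>, with metric \<^const>\<open>dist\<close>; the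
  measure \<open>\<mu>\<^sup>*\<close> is \<open>M\<close>. A complete Borel measure is taken to be the completion of a
  measure on the Borel sets.

  The compactness axiom is stated for closures of open balls. Compactness of the open balls
  themselves would contradict the other axioms: open balls would be clopen, hence have positive
  distance to their complement, and the Gaussian bound would force their indicator functions
  into the finite-dimensional span of the \<open>\<phi> k\<close> with \<open>\<lambda> k = 0\<close>. Compactness of the closures
  for all radii is the same as compactness of all closed balls.
\<close>

locale data_defined_space =
  fixes M :: "'a :: metric_space measure"
    and q :: real
    and lam :: "nat \<Rightarrow> real"
    and phi :: "nat \<Rightarrow> 'a \<Rightarrow> real"
  assumes complete_borel: "\<exists>N. sets N = sets borel \<and> M = completion N"
    and total_mass: "emeasure M UNIV = 1"
    and lam_0: "lam 0 = 0"
    and lam_mono: "incseq lam"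
    and lam_unbounded: "filterlim lam at_top sequentially"
    and phi_continuous: "continuous_on UNIV (phi k)"
    and phi_bounded: "bounded (range (phi k))"
    and phi_integrable: "integrable M (phi k)"
    and phi_orthonormal: "(LINT x|M. phi j x * phi k x) = (if j = k then 1 else 0)"
    and phi_0: "phi 0 x = 1"
    and ball_compact: "r > 0 \<Longrightarrow> compact (closure (ball x r))"
    and q_pos: "q > 0"
    and ball_measure: "\<exists>\<kappa>2>0. \<forall>x. \<forall>r>0. measure M (ball x r) \<le> \<kappa>2 * r powr q"
    and heat_kernel_converges:
      "0 < t \<Longrightarrow> t \<le> 1 \<Longrightarrow> summable (\<lambda>k. exp (- ((lam k)\<^sup>2 * t)) * phi k x * phi k y)"
    and heat_kernel_bound:
      "\<exists>\<kappa>3>0. \<exists>\<kappa>4>0. \<forall>x y t. 0 < t \<longrightarrow> t \<le> 1 \<longrightarrow>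
         \<bar>\<Sum>k. exp (- ((lam k)\<^sup>2 * t)) * phi k x * phi k y\<bar>
           \<le> \<kappa>3 * t powr (- q / 2) * exp (- \<kappa>4 * (dist x y)\<^sup>2 / t)"

definition Ck_real :: "nat \<Rightarrow> (real \<Rightarrow> real) \<Rightarrow> bool" where
  "Ck_real n f \<longleftrightarrow>
     (\<forall>k<n. \<forall>x. (deriv ^^ k) f differentiable (at x)) \<and> continuous_on UNIV ((deriv ^^ n) f)"

text \<open>
  Below, \<open>F\<close> is determined by \<open>b\<close> and inherits its smoothness, so the iterated \<^const>\<open>deriv\<close>
  of \<open>F\<close> are genuine derivatives.
\<close>

definition is_mask :: "real \<Rightarrow> real \<Rightarrow> (real \<Rightarrow> real) \<Rightarrow> bool" where
  "is_mask q \<beta> b \<longleftrightarrow>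
     (\<exists>S::nat. real S > q \<and> Ck_real (S + 1) b \<and> (\<forall>t. b (- t) = b t) \<and>
       (\<exists>F. (\<forall>t>0. b t = (1 + t) powr (- \<beta>) * F (ln t)) \<and>
            (\<exists>c>0. \<forall>k\<le>S + 1. \<forall>t. \<bar>(deriv ^^ k) F t\<bar> \<le> c) \<and>
            (\<exists>c1>0. \<forall>t. F t \<ge> c1)))"

text \<open>
  Elements of \<open>L\<^sup>p\<close> are represented by functions, identified when they agree almost everywhere.
\<close>

definition Lp_space :: "real \<Rightarrow> 'a measure \<Rightarrow> ('a \<Rightarrow> complex) set" where
  "Lp_space p M = {f \<in> borel_measurable M. integrable M (\<lambda>x. norm (f x) powr p)}"

definition Lp_norm :: "real \<Rightarrow> 'a measure \<Rightarrow> ('a \<Rightarrow> complex) \<Rightarrow> real" where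
  "Lp_norm p M f = (LINT x|M. norm (f x) powr p) powr (1 / p)"

definition fourier_coeff :: "'a measure \<Rightarrow> (nat \<Rightarrow> 'a \<Rightarrow> real) \<Rightarrow> ('a \<Rightarrow> complex) \<Rightarrow> nat \<Rightarrow> complex"
  where "fourier_coeff M phi f k = (LINT x|M. f x * complex_of_real (phi k x))"

definition is_b_derivative ::
  "real \<Rightarrow> 'a measure \<Rightarrow> (nat \<Rightarrow> real) \<Rightarrow> (nat \<Rightarrow> 'a \<Rightarrow> real) \<Rightarrow> (real \<Rightarrow> real) \<Rightarrow>
     ('a \<Rightarrow> complex) \<Rightarrow> ('a \<Rightarrow> complex) \<Rightarrow> bool" where
  "is_b_derivative p M lam phi b f h \<longleftrightarrow>
     h \<in> Lp_space p M \<and>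
     (\<forall>k. complex_of_real (b (lam k)) * fourier_coeff M phi h k = fourier_coeff M phi f k)"

definition sobolev ::
  "real \<Rightarrow> 'a measure \<Rightarrow> (nat \<Rightarrow> real) \<Rightarrow> (nat \<Rightarrow> 'a \<Rightarrow> real) \<Rightarrow> (real \<Rightarrow> real) \<Rightarrow> ('a \<Rightarrow> complex) set"
  where "sobolev p M lam phi b =
    {f \<in> Lp_space p M. \<exists>h. is_b_derivative p M lam phi b f h}"

text \<open>
  The choice is immaterial: in a data-defined space the \<open>\<phi> k\<close> are complete (the heat kernel is an
  approximate identity) and \<open>b (\<lambda> k) \<noteq> 0\<close>, so \<open>f\<^sup>(\<^sup>b\<^sup>)\<close> is unique almost everywhere.
\<close>

definition b_derivative ::
  "real \<Rightarrow> 'a measure \<Rightarrow> (nat \<Rightarrow> real) \<Rightarrow> (nat \<Rightarrow> 'a \<Rightarrow> real) \<Rightarrow> (real \<Rightarrow> real) \<Rightarrow>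
     ('a \<Rightarrow> complex) \<Rightarrow> 'a \<Rightarrow> complex" where
  "b_derivative p M lam phi b f = (SOME h. is_b_derivative p M lam phi b f h)"

definition sobolev_norm ::
  "real \<Rightarrow> 'a measure \<Rightarrow> (nat \<Rightarrow> real) \<Rightarrow> (nat \<Rightarrow> 'a \<Rightarrow> real) \<Rightarrow> (real \<Rightarrow> real) \<Rightarrow>
     ('a \<Rightarrow> complex) \<Rightarrow> real" where
  "sobolev_norm p M lam phi b f = Lp_norm p M (b_derivative p M lam phi b f)"

definition kernel_G ::
  "(nat \<Rightarrow> real) \<Rightarrow> (nat \<Rightarrow> 'a \<Rightarrow> real) \<Rightarrow> (real \<Rightarrow> real) \<Rightarrow> 'a \<Rightarrow> 'a \<Rightarrow> real" where
  "kernel_G lam phi b x y = (\<Sum>j. (b (lam j))\<^sup>2 * phi j x * phi j y)"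

text \<open>
  A linear operator on a class \<open>W\<close> of functions modulo equality almost everywhere, whose values
  are functions that can be evaluated at points. For the identity operator, say, \<open>T f\<close> is the
  continuous representative of \<open>f\<close>.
\<close>

definition linear_operator_on ::
  "'a measure \<Rightarrow> ('a \<Rightarrow> complex) set \<Rightarrow> (('a \<Rightarrow> complex) \<Rightarrow> 'a \<Rightarrow> complex) \<Rightarrow> bool" where
  "linear_operator_on M W T \<longleftrightarrow>
     (\<forall>f\<in>W. \<forall>g\<in>W. (AE x in M. f x = g x) \<longrightarrow> T f = T g) \<and>
     (\<forall>f\<in>W. \<forall>g\<in>W. T (\<lambda>x. f x + g x) = (\<lambda>y. T f y + T g y)) \<and>
     (\<forall>f\<in>W. \<forall>c. T (\<lambda>x. c * f x) = (\<lambda>y. c * T f y))"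

text \<open>Evaluation at \<open>y\<close> after \<open>T\<close> is a bounded functional on \<open>W\<close> with respect to the norm \<open>nrm\<close>.\<close>

definition bounded_evaluation ::
  "('a \<Rightarrow> complex) set \<Rightarrow> (('a \<Rightarrow> complex) \<Rightarrow> real) \<Rightarrow>
     (('a \<Rightarrow> complex) \<Rightarrow> 'a \<Rightarrow> complex) \<Rightarrow> 'a \<Rightarrow> bool" where
  "bounded_evaluation W nrm T y \<longleftrightarrow> (\<exists>C. \<forall>g\<in>W. norm (T g y) \<le> C * nrm g)"

text \<open>
  Scalars are complex, while the \<open>\<phi> k\<close>, \<open>b\<close> and the kernel \<open>G\<close> are real. For a functional that is
  not real on real functions, such as a combination of Fourier coefficients \<open>f \<mapsto> c\<^sub>1(f) + \<i> c\<^sub>2(f)\<close>, the representer is the complex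
  conjugate of the functional applied to \<open>G\<close>, and minimizers need not be combinations of the latter.
\<close>

definition real_evaluation ::
  "('a \<Rightarrow> complex) set \<Rightarrow> (('a \<Rightarrow> complex) \<Rightarrow> 'a \<Rightarrow> complex) \<Rightarrow> 'a \<Rightarrow> bool" where
  "real_evaluation W T y \<longleftrightarrow> (\<forall>g\<in>W. (\<forall>x. g x \<in> \<real>) \<longrightarrow> T g y \<in> \<real>)"

end

(*
  Writing a function g of the Sobolev class by its coefficients c_k = hat g(k) / b(lambda_k), the norm of
  g^(b) is the l2-norm of c; this needs completeness of the phi_k, which holds because the heat kernel
  is an approximate identity. The condition beta > q/2 makes sum_k b(lambda_k)^2 phi_k(x)^2 bounded,
  so G(.,x) lies in the class with coefficients b(lambda_k) phi_k(x). A bounded functional l has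
  the form l(g) = sum_k c_k gamma_k with gamma in l2, and then x |-> l(G(.,x)) is the element
  of the class with coefficients gamma. Projecting any feasible g orthogonally onto the span of these
  finitely many elements keeps the constraints and does not increase the norm. No linear
  independence is needed: the dual functions only provide one feasible g.
*)

theory Submission
  imports Defs "HOL-Real_Asymp.Real_Asymp"
begin

section \<open>Two decay estimates\<close>

text \<open>The kernel \<open>heat t x\<close> is not assumed nonnegative, so its unit integral does
  not control its L1 norm. The approximate identity is therefore tested on bounded Lipschitz
  functions with a single cut-off radius r = t^(1/2 - \<epsilon>). Inside the ball, the bounds on
  kernel and measure give t^(-q/2) r^q = t^(-\<epsilon> q), which the Lipschitz factor r outweighs;
  outside, the Gaussian factor exp(-\<kappa> t^(-2 \<epsilon>)) beats t^(-q/2). Orthogonality to all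
  \<open>phi k\<close> then passes from Lipschitz functions to closed sets, Borel sets and finally
  the completed sigma-algebra. Two further obstacles shape the second half. Elements of the class
  matter only up to null sets, while the formula for the minimizer is pointwise;
  \<open>synthesis\<close> supplies the representative for which it holds everywhere. And linearity
  alone does not carry a functional through the infinite series of the kernel: boundedness does, and
  realness removes the conjugation from the coordinates of the representer.\<close>

lemma heat_error_tendsto:
  fixes q K A m \<kappa> :: real
  assumes "q > 0" "\<kappa> > 0"
  defines "\<epsilon> \<equiv> 1 / (4 * (q + 1))"
  shows "(\<lambda>n::nat. K * (real (Suc n) powr (\<epsilon> - 1 / 2)) * (A * real (Suc n) powr (q / 2)) *
            (m * (real (Suc n) powr (\<epsilon> - 1 / 2)) powr q) +
          2 * (A * real (Suc n) powr (q / 2) * exp (- \<kappa> * real (Suc n) powr (2 * \<epsilon>)))) \<longlonglongrightarrow> 0"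
proof -
  have \<epsilon>: "\<epsilon> > 0" "(\<epsilon> - 1 / 2) * (q + 1) + q / 2 = - 1 / 4"
    using assms(1) by (auto simp: \<epsilon>_def field_simps)
  have 1: "K * (X powr (\<epsilon> - 1 / 2)) * (A * X powr (q / 2)) * (m * (X powr (\<epsilon> - 1 / 2)) powr q)
      = K * A * m * X powr (- 1 / 4)" if "X > 0" for X
  proof -
    have "X powr (\<epsilon> - 1 / 2) * X powr (q / 2) * X powr ((\<epsilon> - 1 / 2) * q)
        = X powr ((\<epsilon> - 1 / 2) * (q + 1) + q / 2)"
    proof -
      have "(\<epsilon> - 1 / 2) + q / 2 + (\<epsilon> - 1 / 2) * q = (\<epsilon> - 1 / 2) * (q + 1) + q / 2"
        by (simp add: ring_distribs)
      then show ?thesis by (simp only: powr_add [symmetric])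
    qed
    then show ?thesis using \<epsilon>(2) by (simp add: powr_powr mult_ac)
  qed
  have "(\<lambda>n::nat. real (Suc n) powr (- 1 / 4)) \<longlonglongrightarrow> 0" by real_asymp
  moreover have "(\<lambda>n::nat. real (Suc n) powr (q / 2) * exp (- \<kappa> * real (Suc n) powr (2 * \<epsilon>))) \<longlonglongrightarrow> 0"
    using \<epsilon>(1) assms(1,2) by real_asymp
  ultimately have "(\<lambda>n::nat. K * A * m * real (Suc n) powr (- 1 / 4) + 2 * (A * (real (Suc n) powr (q / 2)
      * exp (- \<kappa> * real (Suc n) powr (2 * \<epsilon>))))) \<longlonglongrightarrow> K * A * m * 0 + 2 * (A * 0)"
    by (intro tendsto_intros)
  then show ?thesis using 1[of "real (Suc _)"] by (simp only: 1 of_nat_0_less_iff zero_less_Suc mult.assoc) simp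
qed

text \<open>The formula in \<open>is_mask\<close> covers t > 0 only, but \<open>lam 0 = 0\<close>,
  so t = 0 is needed too; it follows by a right-hand limit, as differentiability makes
  \<open>b\<close> continuous at 0. The upper constant is the bound on the derivative of order 0 of
  \<open>F\<close>.\<close>

lemma mask_bounds:
  assumes "is_mask q \<beta> b"
  obtains c c1 where "c > 0" "c1 > 0"
    "\<And>t. t \<ge> 0 \<Longrightarrow> c1 * (1 + t) powr (- \<beta>) \<le> b t \<and> b t \<le> c * (1 + t) powr (- \<beta>)"
proof -
  obtain S F c c1 where *: "Ck_real (S + 1) b" "\<And>t. t > 0 \<Longrightarrow> b t = (1 + t) powr (- \<beta>) * F (ln t)"
    "c > 0" "\<And>k t. k \<le> S + 1 \<Longrightarrow> \<bar>(deriv ^^ k) F t\<bar> \<le> c" "c1 > 0" "\<And>t. F t \<ge> c1"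
    using assms unfolding is_mask_def by metis
  have "b differentiable (at 0)"
    using *(1) unfolding Ck_real_def by (auto dest!: spec[of _ 0])
  then have "isCont b 0"
    by (simp add: differentiable_imp_continuous_within)
  then have b0: "(b \<longlongrightarrow> b 0) (at_right 0)"
    unfolding isCont_def by (rule tendsto_within_subset) auto
  have p: "((\<lambda>t. C * (1 + t) powr (- \<beta>)) \<longlongrightarrow> C * (1 + 0) powr (- \<beta>)) (at_right 0)" for C
    by (intro tendsto_intros) auto
  have bd: "c1 * (1 + t) powr (- \<beta>) \<le> b t" "b t \<le> c * (1 + t) powr (- \<beta>)" if "t > 0" for t
    using *(2)[OF that] *(4)[of 0 "ln t"] *(6)[of "ln t"]
    by (auto simp: mult.commute intro!: mult_right_mono)
  have pos: "eventually (\<lambda>t::real. t > 0) (at_right 0)"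
    by (rule eventually_at_right_less)
  have "c1 * (1 + 0) powr (- \<beta>) \<le> b 0"
    by (rule tendsto_le[OF _ b0 p]) (use pos in \<open>auto elim!: eventually_mono intro: bd\<close>)
  moreover have "b 0 \<le> c * (1 + 0) powr (- \<beta>)"
    by (rule tendsto_le[OF _ p b0]) (use pos in \<open>auto elim!: eventually_mono intro: bd\<close>)
  ultimately have "c1 * (1 + t) powr (- \<beta>) \<le> b t \<and> b t \<le> c * (1 + t) powr (- \<beta>)" if "t \<ge> 0" for t
    using bd[of t] that by (cases "t = 0") auto
  then show thesis using that *(3,5) by blast
qed

section \<open>Square-summable sequences\<close>

definition sqsum :: "(nat \<Rightarrow> complex) \<Rightarrow> bool" where
  "sqsum c \<longleftrightarrow> summable (\<lambda>k. (norm (c k))\<^sup>2)"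

definition ell2_inner :: "(nat \<Rightarrow> complex) \<Rightarrow> (nat \<Rightarrow> complex) \<Rightarrow> complex" where
  "ell2_inner c d = (\<Sum>k. c k * cnj (d k))"

lemma sqsum_add:
  assumes "sqsum c" "sqsum d"
  shows "sqsum (\<lambda>k. c k + d k)"
  unfolding sqsum_def
proof (rule summable_comparison_test')
  show "summable (\<lambda>k. 2 * (norm (c k))\<^sup>2 + 2 * (norm (d k))\<^sup>2)"
    using assms by (auto simp: sqsum_def intro!: summable_add summable_mult)
  fix k
  have "(norm (c k + d k))\<^sup>2 \<le> (norm (c k) + norm (d k))\<^sup>2"
    by (intro power_mono norm_triangle_ineq) auto
  also have "\<dots> \<le> 2 * (norm (c k))\<^sup>2 + 2 * (norm (d k))\<^sup>2"
    using sum_squares_bound[of "norm (c k)" "norm (d k)"] by (simp add: power2_sum)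
  finally show "norm ((norm (c k + d k))\<^sup>2) \<le> 2 * (norm (c k))\<^sup>2 + 2 * (norm (d k))\<^sup>2"
    by simp
qed

lemma sqsum_scale: "sqsum c \<Longrightarrow> sqsum (\<lambda>k. a * c k)"
  by (simp add: sqsum_def norm_mult power_mult_distrib summable_mult)

lemma sqsum_diff: "sqsum c \<Longrightarrow> sqsum d \<Longrightarrow> sqsum (\<lambda>k. c k - d k)"
  using sqsum_add[OF _ sqsum_scale[of d "-1"], of c] by simp

lemma sqsum_sum: "(\<And>i. i \<in> I \<Longrightarrow> sqsum (g i)) \<Longrightarrow> sqsum (\<lambda>k. \<Sum>i\<in>I. a i * g i k)"
proof (induction I rule: infinite_finite_induct)
  case (insert i I)
  then show ?case by (simp add: sqsum_add sqsum_scale)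
qed (simp_all add: sqsum_def)

lemma sqsum_mult_summable:
  assumes "sqsum c" "sqsum d"
  shows "summable (\<lambda>k. norm (c k * d k))"
proof (rule summable_comparison_test')
  show "summable (\<lambda>k. (norm (c k))\<^sup>2 + (norm (d k))\<^sup>2)"
    using assms by (auto simp: sqsum_def intro!: summable_add)
  fix k
  have "0 \<le> norm (c k) * norm (d k)" by simp
  then show "norm (norm (c k * d k)) \<le> (norm (c k))\<^sup>2 + (norm (d k))\<^sup>2"
    using sum_squares_bound[of "norm (c k)" "norm (d k)"] unfolding norm_mult by (simp only: norm_mult real_norm_def abs_mult abs_norm_cancel)
qed

lemma sqsum_cnj: "sqsum d \<Longrightarrow> sqsum (\<lambda>k. cnj (d k))"
  by (simp add: sqsum_def)

lemma ell2_summable: "sqsum c \<Longrightarrow> sqsum d \<Longrightarrow> summable (\<lambda>k. c k * cnj (d k))"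
  by (rule summable_norm_cancel) (rule sqsum_mult_summable[OF _ sqsum_cnj])

lemma ell2_inner_add:
  "sqsum c \<Longrightarrow> sqsum c' \<Longrightarrow> sqsum d \<Longrightarrow>
    ell2_inner (\<lambda>k. c k + c' k) d = ell2_inner c d + ell2_inner c' d"
  by (simp add: ell2_inner_def algebra_simps suminf_add ell2_summable)

lemma ell2_inner_scale:
  "sqsum c \<Longrightarrow> sqsum d \<Longrightarrow> ell2_inner (\<lambda>k. a * c k) d = a * ell2_inner c d"
  by (simp add: ell2_inner_def mult.assoc suminf_mult ell2_summable)

lemma ell2_inner_diff:
  "sqsum c \<Longrightarrow> sqsum c' \<Longrightarrow> sqsum d \<Longrightarrow>
    ell2_inner (\<lambda>k. c k - c' k) d = ell2_inner c d - ell2_inner c' d"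
  by (simp add: ell2_inner_def algebra_simps suminf_diff ell2_summable)

lemma ell2_inner_commute: "sqsum c \<Longrightarrow> sqsum d \<Longrightarrow> ell2_inner d c = cnj (ell2_inner c d)"
proof -
  assume "sqsum c" "sqsum d"
  then have "(\<lambda>k. cnj (c k * cnj (d k))) sums cnj (ell2_inner c d)"
    unfolding ell2_inner_def sums_cnj by (intro summable_sums ell2_summable)
  then show ?thesis
    by (simp add: ell2_inner_def sums_iff mult.commute)
qed

lemma ell2_inner_sum_right:
  assumes "sqsum c" "\<And>i. i \<in> I \<Longrightarrow> sqsum (g i)"
  shows "ell2_inner c (\<lambda>k. \<Sum>i\<in>I. a i * g i k) = (\<Sum>i\<in>I. cnj (a i) * ell2_inner c (g i))"
  using assms(2)
proof (induction I rule: infinite_finite_induct)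
  case (insert i I)
  have sq: "sqsum (\<lambda>k. a i * g i k)" "sqsum (\<lambda>k. \<Sum>i\<in>I. a i * g i k)" "sqsum (g i)"
    using insert by (auto intro!: sqsum_sum sqsum_scale)
  have "ell2_inner c (\<lambda>k. a i * g i k + (\<Sum>i\<in>I. a i * g i k))
     = cnj (a i) * ell2_inner c (g i) + ell2_inner c (\<lambda>k. \<Sum>i\<in>I. a i * g i k)"
    using ell2_inner_add[OF sq(1,2) assms(1)] ell2_inner_scale[OF sq(3) assms(1), of "a i"]
      ell2_inner_commute[OF sqsum_add[OF sq(1,2)] assms(1)]
      ell2_inner_commute[OF sq(2) assms(1)] ell2_inner_commute[OF sq(3) assms(1)]
    by simp
  then show ?case using insert by simp
qed (simp_all add: ell2_inner_def)

lemma ell2_inner_self: "sqsum c \<Longrightarrow> ell2_inner c c = complex_of_real (\<Sum>k. (norm (c k))\<^sup>2)"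
  unfolding ell2_inner_def
  by (simp add: suminf_of_real sqsum_def complex_norm_square [symmetric] flip: of_real_power)

lemma ell2_inner_self_zero:
  assumes "sqsum c" "ell2_inner c c = 0"
  shows "c k = 0"
  using assms suminf_eq_zero_iff[of "\<lambda>k. (norm (c k))\<^sup>2"]
  by (simp add: ell2_inner_self sqsum_def)

text \<open>Pythagoras for c = (c - d) + d, with the squared norm of c - d dropped.\<close>

lemma ell2_norm_le_of_orthogonal:
  assumes "sqsum c" "sqsum d" "ell2_inner (\<lambda>k. c k - d k) d = 0"
  shows "(\<Sum>k. (norm (d k))\<^sup>2) \<le> (\<Sum>k. (norm (c k))\<^sup>2)"
proof -
  define e where "e = (\<lambda>k. c k - d k)"
  have e: "sqsum e" "ell2_inner e d = 0" "c = (\<lambda>k. e k + d k)"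
    using assms by (auto simp: e_def sqsum_diff)
  have "ell2_inner c c = ell2_inner e e + ell2_inner d d"
    using e assms(1,2) ell2_inner_add[OF e(1) assms(2) assms(1)]
      ell2_inner_commute[OF assms(1) e(1)] ell2_inner_commute[OF assms(1,2)]
      ell2_inner_add[OF e(1) assms(2) e(1)] ell2_inner_add[OF e(1) assms(2) assms(2)]
      ell2_inner_commute[OF e(1) assms(2)] ell2_inner_commute[OF e(1) e(1)]
      ell2_inner_commute[OF assms(2) assms(2)]
    by simp
  then have "complex_of_real (\<Sum>k. (norm (c k))\<^sup>2) =
      complex_of_real ((\<Sum>k. (norm (e k))\<^sup>2) + (\<Sum>k. (norm (d k))\<^sup>2))"
    by (simp add: ell2_inner_self assms e(1))
  then have "(\<Sum>k. (norm (c k))\<^sup>2) = (\<Sum>k. (norm (e k))\<^sup>2) + (\<Sum>k. (norm (d k))\<^sup>2)"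
    using of_real_eq_iff by blast
  moreover have "0 \<le> (\<Sum>k. (norm (e k))\<^sup>2)"
    using e(1) by (intro suminf_nonneg) (auto simp: sqsum_def)
  ultimately show ?thesis by simp
qed

text \<open>Gram-Schmidt on a possibly dependent family. The induction hypothesis is applied to
  \<open>c\<close> and to the new vector \<open>g i0\<close>, hence \<open>c\<close> is arbitrary.
  Removing from the residual of \<open>c\<close> its component along the residual of
  \<open>g i0\<close> keeps the orthogonality already reached.\<close>

lemma ell2_projection:
  assumes "finite I" "\<And>i. i \<in> I \<Longrightarrow> sqsum (g i)" "sqsum c"
  shows "\<exists>a. \<forall>i\<in>I. ell2_inner (\<lambda>k. c k - (\<Sum>j\<in>I. a j * g j k)) (g i) = 0"
  using assms
proof (induction I arbitrary: c rule: finite_induct)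
  case (insert i0 I)
  have g: "\<And>i. i \<in> I \<Longrightarrow> sqsum (g i)" "sqsum (g i0)" using insert by auto
  obtain \<beta> where \<beta>: "\<And>i. i \<in> I \<Longrightarrow> ell2_inner (\<lambda>k. g i0 k - (\<Sum>j\<in>I. \<beta> j * g j k)) (g i) = 0"
    using insert.IH[OF g] by blast
  obtain \<alpha> where \<alpha>: "\<And>i. i \<in> I \<Longrightarrow> ell2_inner (\<lambda>k. c k - (\<Sum>j\<in>I. \<alpha> j * g j k)) (g i) = 0"
    using insert.IH[OF g(1) insert.prems(2)] by blast
  define e where "e = (\<lambda>k. g i0 k - (\<Sum>j\<in>I. \<beta> j * g j k))"
  define v where "v = (\<lambda>k. c k - (\<Sum>j\<in>I. \<alpha> j * g j k))"
  \<comment> \<open>If \<open>g i0\<close> depends on the older vectors, \<open>e\<close> vanishes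
    and division by zero gives \<tau> = 0, so the new vector contributes nothing.\<close>
  define \<tau> where "\<tau> = ell2_inner v e / ell2_inner e e"
  define w where "w = (\<lambda>k. v k - \<tau> * e k)"
  have sq: "sqsum e" "sqsum v" "sqsum w" "sqsum (\<lambda>k. \<tau> * e k)"
    using g insert.prems by (auto simp: e_def v_def w_def intro!: sqsum_diff sqsum_sum sqsum_scale)
  have wI: "ell2_inner w (g i) = 0" if "i \<in> I" for i
    using that \<alpha>[OF that] \<beta>[OF that] ell2_inner_diff[OF sq(2,4) g(1)[OF that]]
      ell2_inner_scale[OF sq(1) g(1)[OF that], of \<tau>]
    by (simp add: w_def flip: e_def v_def)
  have we: "ell2_inner w e = 0"
  proof (cases "ell2_inner e e = 0")
    case True
    then have "e = (\<lambda>_. 0)" using ell2_inner_self_zero[OF sq(1)] by auto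
    then show ?thesis by (simp add: ell2_inner_def)
  next
    case False
    then show ?thesis
      using ell2_inner_diff[OF sq(2,4,1)] ell2_inner_scale[OF sq(1,1), of \<tau>]
      by (simp add: w_def \<tau>_def)
  qed
  \<comment> \<open>\<open>g i0\<close> is \<open>e\<close> plus a combination of the older vectors,
    and \<open>w\<close> is orthogonal to both parts.\<close>
  have sS: "sqsum (\<lambda>k. \<Sum>i\<in>I. \<beta> i * g i k)" using g by (intro sqsum_sum)
  have "ell2_inner w (\<lambda>k. \<Sum>i\<in>I. \<beta> i * g i k) = 0"
    using wI by (simp add: ell2_inner_sum_right sq g)
  then have "ell2_inner (\<lambda>k. e k + (\<Sum>i\<in>I. \<beta> i * g i k)) w = 0"
    using we ell2_inner_add[OF sq(1) sS sq(3)] ell2_inner_commute[OF sq(3,1)]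
      ell2_inner_commute[OF sq(3) sS]
    by simp
  then have w0: "ell2_inner w (g i0) = 0"
    using ell2_inner_commute[OF g(2) sq(3)] by (simp add: e_def)
  define a where "a = (\<lambda>i. if i = i0 then \<tau> else \<alpha> i - \<tau> * \<beta> i)"
  have "(\<Sum>j\<in>insert i0 I. a j * g j k) = \<tau> * g i0 k + (\<Sum>j\<in>I. (\<alpha> j - \<tau> * \<beta> j) * g j k)" for k
    using insert.hyps by (auto simp: a_def intro!: sum.cong)
  then have "w = (\<lambda>k. c k - (\<Sum>j\<in>insert i0 I. a j * g j k))"
    by (auto simp: w_def v_def e_def fun_eq_iff algebra_simps sum_subtractf sum_distrib_left)
  then show ?case using wI w0 by (intro exI[of _ a]) auto
qed auto

section \<open>Expansions in the orthonormal system\<close>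

lemma Lp_space_2: "f \<in> Lp_space 2 M \<longleftrightarrow> f \<in> borel_measurable M \<and> integrable M (\<lambda>x. (norm (f x))\<^sup>2)"
  by (simp add: Lp_space_def)

lemma Lp_norm_2: "Lp_norm 2 M f = sqrt (LINT x|M. (norm (f x))\<^sup>2)"
  by (simp add: Lp_norm_def powr_half_sqrt integral_nonneg_AE)

lemma Lp_space_2_add:
  assumes "f \<in> Lp_space 2 M" "g \<in> Lp_space 2 M"
  shows "(\<lambda>x. f x + g x) \<in> Lp_space 2 M"
proof -
  have [measurable]: "f \<in> borel_measurable M" "g \<in> borel_measurable M"
    using assms by (auto simp: Lp_space_2)
  have "integrable M (\<lambda>x. (norm (f x + g x))\<^sup>2)"
  proof (rule Bochner_Integration.integrable_bound)
    show "integrable M (\<lambda>x. 2 * (norm (f x))\<^sup>2 + 2 * (norm (g x))\<^sup>2)"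
      using assms by (auto simp: Lp_space_2)
    have "(norm (f x + g x))\<^sup>2 \<le> 2 * (norm (f x))\<^sup>2 + 2 * (norm (g x))\<^sup>2" for x
    proof -
      have "(norm (f x + g x))\<^sup>2 \<le> (norm (f x) + norm (g x))\<^sup>2"
        by (intro power_mono norm_triangle_ineq) auto
      also have "\<dots> \<le> 2 * (norm (f x))\<^sup>2 + 2 * (norm (g x))\<^sup>2"
        using sum_squares_bound[of "norm (f x)" "norm (g x)"] by (simp add: power2_sum)
      finally show ?thesis .
    qed
    then show "AE x in M. norm ((norm (f x + g x))\<^sup>2)
        \<le> norm (2 * (norm (f x))\<^sup>2 + 2 * (norm (g x))\<^sup>2)" by (intro AE_I2) (simp add: abs_of_nonneg)
  qed measurable
  then show ?thesis by (simp add: Lp_space_2)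
qed

lemma Lp_space_2_scale: "f \<in> Lp_space 2 M \<Longrightarrow> (\<lambda>x. c * f x) \<in> Lp_space 2 M"
  by (auto simp: Lp_space_2 norm_mult power_mult_distrib)

lemma Lp_space_2_diff:
  "f \<in> Lp_space 2 M \<Longrightarrow> g \<in> Lp_space 2 M \<Longrightarrow> (\<lambda>x. f x - g x) \<in> Lp_space 2 M"
  using Lp_space_2_add[of f M "\<lambda>x. (-1) * g x"] Lp_space_2_scale[of g M "-1"] by simp

context data_defined_space
begin

section \<open>Integration against a completed Borel measure of mass one\<close>

lemma space_eq_UNIV: "space M = UNIV"
proof -
  obtain N where "sets N = sets borel" "M = completion N" using complete_borel by blast
  then show ?thesis using sets_eq_imp_space_eq[of N borel] by simp
qed

lemma borel_measurable_imp: "f \<in> borel_measurable borel \<Longrightarrow> f \<in> borel_measurable M"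
proof -
  assume f: "f \<in> borel_measurable borel"
  obtain N where "sets N = sets borel" "M = completion N" using complete_borel by blast
  moreover from this have "f \<in> borel_measurable N"
    using f measurable_cong_sets[of N borel borel borel] by blast
  ultimately show ?thesis using measurable_completion[of f N] by blast
qed

lemma borel_sets_imp: "A \<in> sets borel \<Longrightarrow> A \<in> sets M"
  using complete_borel by auto

sublocale prob: finite_measure M
  by (rule finite_measureI) (simp add: space_eq_UNIV total_mass)

lemma measure_UNIV: "measure M UNIV = 1"
  by (simp add: measure_def total_mass)

lemma phi_measurable [measurable]: "phi k \<in> borel_measurable M"
  by (intro borel_measurable_imp borel_measurable_continuous_onI phi_continuous)

lemma integrable_bounded:
  fixes f :: "'a \<Rightarrow> 'b::{banach, second_countable_topology}"
  assumes "f \<in> borel_measurable M" "\<And>x. norm (f x) \<le> B"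
  shows "integrable M f"
  using assms by (intro prob.integrable_const_bound[where B = B]) auto

lemma integrable_mult_bounded:
  fixes f g :: "'a \<Rightarrow> 'b::{real_normed_field, banach, second_countable_topology}"
  assumes f: "integrable M f" and [measurable]: "g \<in> borel_measurable M" and "\<And>x. norm (g x) \<le> B"
  shows "integrable M (\<lambda>x. f x * g x)"
proof (rule Bochner_Integration.integrable_bound)
  show "integrable M (\<lambda>x. f x * of_real B)" using f by simp
  show "(\<lambda>x. f x * g x) \<in> borel_measurable M" using f by measurable
  show "AE x in M. norm (f x * g x) \<le> norm (f x * of_real B)"
  proof (intro AE_I2)
    fix x
    have "norm (g x) \<le> \<bar>B\<bar>" using assms(3)[of x] by linarith
    then show "norm (f x * g x) \<le> norm (f x * of_real B)"
      by (simp add: norm_mult mult_left_mono)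
  qed
qed

lemma phi_bound: "\<exists>B. \<forall>x. \<bar>phi k x\<bar> \<le> B"
  using phi_bounded[of k] unfolding bounded_iff by auto

lemma integrable_phi_mult:
  fixes f :: "'a \<Rightarrow> 'b::{real_normed_field, banach, second_countable_topology}"
  assumes "integrable M f"
  shows "integrable M (\<lambda>x. f x * of_real (phi k x))"
proof -
  obtain B where "\<And>x. \<bar>phi k x\<bar> \<le> B" using phi_bound by blast
  then show ?thesis by (intro integrable_mult_bounded[where B = B] assms) auto
qed

text \<open>Dominated convergence with a multiple of norm v as majorant; a bound on the partial sums
  uniform in n and x is enough. It is applied to rows of the heat kernel, to smoothed test functions
  and to synthesised functions.\<close>

lemma series_integral:
  fixes w :: "nat \<Rightarrow> 'b::{real_normed_field, banach, second_countable_topology}"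
  assumes bnd: "\<And>n x. norm (\<Sum>k<n. w k * of_real (phi k x)) \<le> B"
    and conv: "\<And>x. summable (\<lambda>k. w k * of_real (phi k x))"
    and v: "integrable M v"
  shows "(\<lambda>k. w k * (LINT x|M. v x * of_real (phi k x))) sums
    (LINT x|M. v x * (\<Sum>k. w k * of_real (phi k x)))"
proof -
  have [measurable]: "v \<in> borel_measurable M" using v by auto
  have "(\<lambda>n. LINT x|M. v x * (\<Sum>k<n. w k * of_real (phi k x))) \<longlonglongrightarrow>
     (LINT x|M. v x * (\<Sum>k. w k * of_real (phi k x)))"
  proof (rule integral_dominated_convergence[where w = "\<lambda>x. norm (v x) * B"])
    show "integrable M (\<lambda>x. norm (v x) * B)" using v by auto
    show "AE x in M. (\<lambda>n. v x * (\<Sum>k<n. w k * of_real (phi k x))) \<longlonglongrightarrow>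
        v x * (\<Sum>k. w k * of_real (phi k x))"
      using conv by (intro AE_I2 tendsto_mult_left summable_LIMSEQ) auto
    show "AE x in M. norm (v x * (\<Sum>k<n. w k * of_real (phi k x))) \<le> norm (v x) * B" for n
      using bnd by (intro AE_I2) (simp add: norm_mult mult_left_mono)
  qed measurable
  moreover have "(LINT x|M. v x * (\<Sum>k<n. w k * of_real (phi k x)))
      = (\<Sum>k<n. w k * (LINT x|M. v x * of_real (phi k x)))" for n
  proof -
    have "(LINT x|M. v x * (\<Sum>k<n. w k * of_real (phi k x)))
      = (LINT x|M. (\<Sum>k<n. w k * (v x * of_real (phi k x))))"
      by (simp add: sum_distrib_left mult.left_commute)
    also have "\<dots> = (\<Sum>k<n. LINT x|M. w k * (v x * of_real (phi k x)))"
      by (intro Bochner_Integration.integral_sum integrable_mult_right integrable_phi_mult v)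
    finally show ?thesis by simp
  qed
  ultimately show ?thesis by (simp add: sums_def)
qed

text \<open>Nonnegativity of the variance under a measure of total mass one; through it L2 estimates
  become L1 estimates.\<close>

lemma square_mean_le:
  fixes f :: "'a \<Rightarrow> real"
  assumes "integrable M f" "integrable M (\<lambda>x. (f x)\<^sup>2)"
  shows "(LINT x|M. f x)\<^sup>2 \<le> (LINT x|M. (f x)\<^sup>2)"
proof -
  define m where "m = (LINT x|M. f x)"
  have "0 \<le> (LINT x|M. (f x - m)\<^sup>2)" by simp
  also have "(\<lambda>x. (f x - m)\<^sup>2) = (\<lambda>x. (f x)\<^sup>2 - 2 * m * f x + m\<^sup>2)"
    by (auto simp: power2_diff algebra_simps)
  also have "(LINT x|M. (f x)\<^sup>2 - 2 * m * f x + m\<^sup>2) = (LINT x|M. (f x)\<^sup>2) - m\<^sup>2"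
    using assms by (simp add: space_eq_UNIV measure_UNIV m_def power2_eq_square)
  finally show ?thesis by (simp add: m_def)
qed

lemma Lp_space_2_integrable:
  assumes "f \<in> Lp_space 2 M"
  shows "integrable M f"
proof -
  have "integrable M (\<lambda>x. norm (f x))"
    by (rule prob.square_integrable_imp_integrable) (use assms in \<open>auto simp: Lp_space_2\<close>)
  then show ?thesis using assms integrable_norm_iff[of f M] by (simp add: Lp_space_2)
qed

lemma L1_le_L2:
  assumes "f \<in> Lp_space 2 M"
  shows "(LINT x|M. norm (f x))\<^sup>2 \<le> (LINT x|M. (norm (f x))\<^sup>2)"
  using assms Lp_space_2_integrable[OF assms]
  by (intro square_mean_le integrable_norm) (simp_all add: Lp_space_2)

lemma Lp_space_2_bounded:
  assumes "f \<in> borel_measurable M" "\<And>x. norm (f x) \<le> B"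
  shows "f \<in> Lp_space 2 M"
proof -
  have "norm ((norm (f x))\<^sup>2) \<le> B\<^sup>2" for x
    using power_mono[OF assms(2) norm_ge_zero, of x 2] by simp
  then show ?thesis
    using assms(1) by (auto simp: Lp_space_2 intro!: integrable_bounded[where B = "B\<^sup>2"])
qed

section \<open>Fourier coefficients, finite Fourier sums and Bessel's identity\<close>

abbreviation "fcoeff \<equiv> fourier_coeff M phi"

lemma fcoeff_add:
  "f \<in> Lp_space 2 M \<Longrightarrow> g \<in> Lp_space 2 M \<Longrightarrow> fcoeff (\<lambda>x. f x + g x) k = fcoeff f k + fcoeff g k"
  by (simp add: fourier_coeff_def distrib_right integrable_phi_mult Lp_space_2_integrable)

lemma fcoeff_scale: "fcoeff (\<lambda>x. c * f x) k = c * fcoeff f k"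
  by (simp add: fourier_coeff_def mult.assoc)

lemma fcoeff_diff:
  "f \<in> Lp_space 2 M \<Longrightarrow> g \<in> Lp_space 2 M \<Longrightarrow> fcoeff (\<lambda>x. f x - g x) k = fcoeff f k - fcoeff g k"
  by (simp add: fourier_coeff_def left_diff_distrib integrable_phi_mult Lp_space_2_integrable)

lemma phi_Lp: "(\<lambda>x. complex_of_real (phi k x)) \<in> Lp_space 2 M"
proof -
  obtain B where "\<And>x. \<bar>phi k x\<bar> \<le> B" using phi_bound by blast
  then show ?thesis by (intro Lp_space_2_bounded[where B = B]) auto
qed

lemma fcoeff_phi: "fcoeff (\<lambda>x. complex_of_real (phi j x)) k = (if j = k then 1 else 0)"
proof -
  have "fcoeff (\<lambda>x. complex_of_real (phi j x)) k = complex_of_real (LINT x|M. phi j x * phi k x)"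
    by (simp add: fourier_coeff_def flip: of_real_mult integral_complex_of_real)
  then show ?thesis by (simp add: phi_orthonormal)
qed

definition fourier_sum :: "(nat \<Rightarrow> complex) \<Rightarrow> nat set \<Rightarrow> 'a \<Rightarrow> complex" where
  "fourier_sum c A x = (\<Sum>k\<in>A. c k * complex_of_real (phi k x))"

lemma fourier_sum_Lp: "fourier_sum c A \<in> Lp_space 2 M"
proof (induction A rule: infinite_finite_induct)
  case (insert i A)
  have "fourier_sum c (insert i A) = (\<lambda>x. c i * complex_of_real (phi i x) + fourier_sum c A x)"
    using insert by (auto simp: fourier_sum_def)
  then show ?case using insert by (auto intro!: Lp_space_2_add Lp_space_2_scale phi_Lp)
qed (auto simp: fourier_sum_def[abs_def] Lp_space_2)

lemma fcoeff_fourier_sum: "finite A \<Longrightarrow> fcoeff (fourier_sum c A) k = (if k \<in> A then c k else 0)"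
proof (induction A rule: finite_induct)
  case (insert i A)
  have "fourier_sum c (insert i A) = (\<lambda>x. c i * complex_of_real (phi i x) + fourier_sum c A x)"
    using insert by (auto simp: fourier_sum_def)
  then show ?case
    using insert by (auto simp: fcoeff_add fcoeff_scale fcoeff_phi fourier_sum_Lp Lp_space_2_scale phi_Lp)
qed (simp add: fourier_sum_def[abs_def] fourier_coeff_def)

text \<open>Expanding the square for one basis function is the induction step both for the norm of a
  finite Fourier sum and for Bessel's identity.\<close>

lemma norm_diff_phi:
  assumes u: "u \<in> Lp_space 2 M"
  shows "(LINT x|M. (norm (u x - c * complex_of_real (phi k x)))\<^sup>2)
    = (LINT x|M. (norm (u x))\<^sup>2) - 2 * Re (cnj c * fcoeff u k) + (norm c)\<^sup>2"
proof -
  have iu: "integrable M (\<lambda>x. u x * complex_of_real (phi k x))"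
    by (intro integrable_phi_mult Lp_space_2_integrable u)
  have ip: "integrable M (\<lambda>x. phi k x * phi k x)"
    using integrable_phi_mult[OF phi_integrable, of k k] by simp
  have "(norm (u x - c * complex_of_real (phi k x)))\<^sup>2
     = (norm (u x))\<^sup>2 - 2 * Re (cnj c * (u x * complex_of_real (phi k x)))
       + (norm c)\<^sup>2 * (phi k x * phi k x)" for x
    by (simp add: cmod_power2) (simp add: power2_eq_square algebra_simps)
  moreover have "(LINT x|M. Re (cnj c * (u x * complex_of_real (phi k x))))
     = Re (cnj c * fcoeff u k)"
    using iu unfolding fourier_coeff_def by (subst integral_Re) auto
  moreover have "integrable M (\<lambda>x. Re (cnj c * (u x * complex_of_real (phi k x))))"
    using iu by (intro integrable_Re) auto
  ultimately show ?thesis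
    using u ip by (simp add: Lp_space_2 phi_orthonormal del: Re_complex_of_real times_complex.sel)
qed

lemma norm_fourier_sum:
  "finite A \<Longrightarrow> (LINT x|M. (norm (fourier_sum c A x))\<^sup>2) = (\<Sum>k\<in>A. (norm (c k))\<^sup>2)"
proof (induction A rule: finite_induct)
  case (insert i A)
  have "fourier_sum c (insert i A) = (\<lambda>x. fourier_sum c A x - (- c i) * complex_of_real (phi i x))"
    using insert by (auto simp: fourier_sum_def)
  then show ?case
    using insert norm_diff_phi[OF fourier_sum_Lp, of c A "- c i" i] by (simp add: fcoeff_fourier_sum)
qed (simp add: fourier_sum_def)

lemma bessel_identity:
  assumes h: "h \<in> Lp_space 2 M"
  shows "(LINT x|M. (norm (h x - fourier_sum (fcoeff h) {..<n} x))\<^sup>2)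
    = (LINT x|M. (norm (h x))\<^sup>2) - (\<Sum>k<n. (norm (fcoeff h k))\<^sup>2)"
proof (induction n)
  case (Suc n)
  define u where "u = (\<lambda>x. h x - fourier_sum (fcoeff h) {..<n} x)"
  have u: "u \<in> Lp_space 2 M" unfolding u_def by (intro Lp_space_2_diff h fourier_sum_Lp)
  have un: "fcoeff u n = fcoeff h n"
    unfolding u_def by (subst fcoeff_diff) (auto simp: h fourier_sum_Lp fcoeff_fourier_sum)
  have eq: "h x - fourier_sum (fcoeff h) {..<Suc n} x
      = u x - fcoeff h n * complex_of_real (phi n x)" for x
    by (auto simp: u_def fourier_sum_def)
  have "Re (cnj (fcoeff h n) * fcoeff h n) = (norm (fcoeff h n))\<^sup>2"
    by (simp add: cmod_power2) (simp add: power2_eq_square)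
  then have "(LINT x|M. (norm (u x - fcoeff h n * complex_of_real (phi n x)))\<^sup>2)
      = (LINT x|M. (norm (u x))\<^sup>2) - (norm (fcoeff h n))\<^sup>2"
    using norm_diff_phi[OF u, of "fcoeff h n" n] un by simp
  then show ?case
    using Suc unfolding eq by (simp add: u_def)
qed (simp add: fourier_sum_def)

section \<open>Heat kernel and completeness\<close>

text \<open>By 2ab \<le> a^2 + b^2, nonnegative weights let the diagonal control all pairs of
  points. The weights will be the heat factors and the squared mask values.\<close>

lemma partial_sum_bound:
  assumes w: "\<And>k. 0 \<le> w k" and B: "\<And>n x. (\<Sum>k<n. w k * (phi k x)\<^sup>2) \<le> B"
  shows "(\<Sum>k<n. \<bar>w k * phi k x * phi k y\<bar>) \<le> B"
proof -
  have "(\<Sum>k<n. \<bar>w k * phi k x * phi k y\<bar>)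
      \<le> (\<Sum>k<n. (w k * (phi k x)\<^sup>2 + w k * (phi k y)\<^sup>2) / 2)"
  proof (intro sum_mono)
    fix k
    have "\<bar>phi k x\<bar> * \<bar>phi k y\<bar> \<le> ((phi k x)\<^sup>2 + (phi k y)\<^sup>2) / 2"
      using sum_squares_bound[of "\<bar>phi k x\<bar>" "\<bar>phi k y\<bar>"] by simp
    then have "w k * (\<bar>phi k x\<bar> * \<bar>phi k y\<bar>) \<le> w k * (((phi k x)\<^sup>2 + (phi k y)\<^sup>2) / 2)"
      by (rule mult_left_mono) (rule w)
    then show "\<bar>w k * phi k x * phi k y\<bar> \<le> (w k * (phi k x)\<^sup>2 + w k * (phi k y)\<^sup>2) / 2"
      using w[of k] by (simp add: abs_mult algebra_simps)
  qed
  also have "\<dots> = ((\<Sum>k<n. w k * (phi k x)\<^sup>2) + (\<Sum>k<n. w k * (phi k y)\<^sup>2)) / 2"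
    by (simp add: sum.distrib flip: sum_divide_distrib)
  also have "\<dots> \<le> B" using B[of x n] B[of y n] by simp
  finally show ?thesis .
qed

lemma partial_sum_summable:
  assumes w: "\<And>k. 0 \<le> w k" and B: "\<And>n x. (\<Sum>k<n. w k * (phi k x)\<^sup>2) \<le> B"
  shows "summable (\<lambda>k. w k * phi k x * phi k y)"
  using partial_sum_bound[OF assms]
  by (intro summable_norm_cancel[of "\<lambda>k. w k * phi k x * phi k y"] summableI_nonneg_bounded[where x = B]) auto

definition heat :: "real \<Rightarrow> 'a \<Rightarrow> 'a \<Rightarrow> real" where
  "heat t x y = (\<Sum>k. exp (- ((lam k)\<^sup>2 * t)) * phi k x * phi k y)"

text \<open>The axioms bound only the full series. On the diagonal its terms are nonnegative, so the
  partial sums inherit the bound.\<close>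

lemma heat_diag:
  assumes "0 < t" "t \<le> 1" "\<And>x y. \<bar>heat t x y\<bar> \<le> B"
  shows "(\<Sum>k<n. exp (- ((lam k)\<^sup>2 * t)) * (phi k x)\<^sup>2) \<le> B"
proof -
  have "(\<Sum>k<n. exp (- ((lam k)\<^sup>2 * t)) * phi k x * phi k x) \<le> heat t x x"
    unfolding heat_def using heat_kernel_converges[OF assms(1,2)]
    by (intro sum_le_suminf) (auto simp: mult.assoc)
  also have "\<dots> \<le> B" using assms(3)[of x x] by linarith
  finally show ?thesis by (simp add: power2_eq_square mult.assoc)
qed

lemma heat_measurable [measurable]: "heat t x \<in> borel_measurable M"
  unfolding heat_def[abs_def] by measurable

lemma heat_partial_sum:
  assumes "0 < t" "t \<le> 1" "\<And>x y. \<bar>heat t x y\<bar> \<le> B"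
  shows "\<bar>\<Sum>k<n. exp (- ((lam k)\<^sup>2 * t)) * phi k x * phi k y\<bar> \<le> B"
  by (rule order_trans[OF sum_abs]) (rule partial_sum_bound[OF _ heat_diag[OF assms]], simp)

lemma heat_integral:
  assumes t: "0 < t" "t \<le> 1" and B: "\<And>x y. \<bar>heat t x y\<bar> \<le> B" and v: "integrable M v"
  shows "(\<lambda>k. exp (- ((lam k)\<^sup>2 * t)) * phi k x * (LINT y|M. v y * phi k y)) sums
    (LINT y|M. v y * heat t x y)"
proof -
  have "norm (\<Sum>k<n. exp (- ((lam k)\<^sup>2 * t)) * phi k x * of_real (phi k y)) \<le> B" for n y
    using heat_partial_sum[OF t B] by simp
  then show ?thesis
    using series_integral[where w = "\<lambda>k. exp (- ((lam k)\<^sup>2 * t)) * phi k x" and v = v and B = B]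
      heat_kernel_converges[OF t] v by (simp add: heat_def)
qed

text \<open>Conservation of mass: orthogonality to \<open>phi 0\<close>, the constant one, kills
  every other mode, and \<open>lam 0 = 0\<close> leaves that mode undamped.\<close>

lemma heat_integral_1:
  assumes t: "0 < t" "t \<le> 1" and B: "\<And>x y. \<bar>heat t x y\<bar> \<le> B"
  shows "(LINT y|M. heat t x y) = 1"
proof -
  have "(LINT y|M. phi k y) = (if k = 0 then 1 else 0)" for k
    using phi_orthonormal[of 0 k] by (simp add: phi_0 cong: if_cong)
  then have "(\<lambda>k. exp (- ((lam k)\<^sup>2 * t)) * phi k x * (LINT y|M. phi k y))
      = (\<lambda>k. if k = 0 then 1 else 0)"
    by (auto simp: lam_0 phi_0)
  then show ?thesis
    using heat_integral[OF t B, of "\<lambda>_. 1" x] sums_single[of 0 "\<lambda>_. 1::real"]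
    by (auto dest: sums_unique2)
qed

text \<open>Any radius \<open>r\<close> may be used here; \<open>r\<close> slightly larger than \<open>sqrt t\<close> makes both terms small.\<close>

lemma heat_approx:
  assumes t: "0 < t" "t \<le> 1" and "0 < r" "0 \<le> A" "0 \<le> E" "0 \<le> m"
    and bnd: "\<And>x y. \<bar>heat t x y\<bar> \<le> A"
    and off: "\<And>x y. r \<le> dist x y \<Longrightarrow> \<bar>heat t x y\<bar> \<le> E"
    and ball: "\<And>x. measure M (ball x r) \<le> m"
    and g: "continuous_on UNIV g" "\<And>x. \<bar>g x\<bar> \<le> 1"
    and lip: "\<And>x y. \<bar>g x - g y\<bar> \<le> K * dist x y" and K: "0 \<le> K"
  shows "\<bar>(LINT y|M. g y * heat t x y) - g x\<bar> \<le> K * r * A * m + 2 * E"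
proof -
  have [measurable]: "g \<in> borel_measurable M"
    using g by (intro borel_measurable_imp borel_measurable_continuous_onI)
  have [measurable]: "ball x r \<in> sets M" by (intro borel_sets_imp) auto
  have ih: "integrable M (heat t x)" by (intro integrable_bounded[where B = A]) (auto simp: bnd)
  have ig: "integrable M (\<lambda>y. g y * heat t x y)"
    using integrable_mult_bounded[OF ih, of g 1] g(2) by (simp add: mult.commute)
  have ib: "integrable M (\<lambda>y. K * r * A * indicator (ball x r) y)"
    by (intro integrable_mult_right integrable_real_indicator)
      (auto simp: prob.emeasure_finite less_top[symmetric])
  \<comment> \<open>The unit mass of the kernel brings \<open>g x\<close> under the integral, so
    only increments of \<open>g\<close> need estimating.\<close>
  have "(LINT y|M. g y * heat t x y) - g x = (LINT y|M. (g y - g x) * heat t x y)"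
    using ig ih heat_integral_1[OF t bnd, of x] by (simp add: left_diff_distrib)
  also have "\<bar>\<dots>\<bar> \<le> (LINT y|M. \<bar>(g y - g x) * heat t x y\<bar>)"
    using integral_norm_bound[of M "\<lambda>y. (g y - g x) * heat t x y"] by simp
  also have "\<dots> \<le> (LINT y|M. K * r * A * indicator (ball x r) y + 2 * E)"
  proof (rule integral_mono)
    show "integrable M (\<lambda>y. \<bar>(g y - g x) * heat t x y\<bar>)"
      using ig ih by (simp add: left_diff_distrib)
    show "integrable M (\<lambda>y. K * r * A * indicator (ball x r) y + 2 * E)"
      using ib by simp
    fix y
    show "\<bar>(g y - g x) * heat t x y\<bar> \<le> K * r * A * indicator (ball x r) y + 2 * E"
    proof (cases "dist x y < r")
      case True
      have "\<bar>g y - g x\<bar> \<le> K * r"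
        using lip[of y x] True mult_left_mono[of "dist x y" r K] K by (simp add: dist_commute)
      then have "\<bar>g y - g x\<bar> * \<bar>heat t x y\<bar> \<le> (K * r) * A"
        using bnd K \<open>0 < r\<close> by (intro mult_mono) auto
      then show ?thesis using True \<open>0 \<le> E\<close> by (simp add: abs_mult)
    next
      case False
      have "\<bar>g y - g x\<bar> \<le> 2" using g(2)[of x] g(2)[of y] by linarith
      then have "\<bar>g y - g x\<bar> * \<bar>heat t x y\<bar> \<le> 2 * E"
        using off False by (intro mult_mono) auto
      then show ?thesis using False by (simp add: abs_mult)
    qed
  qed
  also have "\<dots> = K * r * A * measure M (ball x r) + 2 * E"
    using ib by (subst Bochner_Integration.integral_add) (simp_all add: space_eq_UNIV measure_UNIV)
  also have "\<dots> \<le> K * r * A * m + 2 * E"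
    using ball K \<open>0 < r\<close> \<open>0 \<le> A\<close> by (intro add_right_mono mult_left_mono) auto
  finally show ?thesis .
qed

text \<open>An error bound independent of x can later be integrated against any integrable
  function.\<close>

lemma heat_approx_uniform:
  assumes g: "continuous_on UNIV g" "\<And>x. \<bar>g x\<bar> \<le> 1"
    and lip: "\<And>x y. \<bar>g x - g y\<bar> \<le> K * dist x y" and K: "0 \<le> K"
  obtains e :: "nat \<Rightarrow> real" where "e \<longlonglongrightarrow> 0"
    "\<And>n x. \<bar>(LINT y|M. g y * heat (1 / real (Suc n)) x y) - g x\<bar> \<le> e n"
proof -
  obtain \<kappa>2 where \<kappa>2: "\<kappa>2 > 0" "\<And>x r. r > 0 \<Longrightarrow> measure M (ball x r) \<le> \<kappa>2 * r powr q"
    using ball_measure by blast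
  obtain \<kappa>3 \<kappa>4 where \<kappa>: "\<kappa>3 > 0" "\<kappa>4 > 0" "\<And>t x y. 0 < t \<Longrightarrow> t \<le> 1 \<Longrightarrow>
      \<bar>heat t x y\<bar> \<le> \<kappa>3 * t powr (- q / 2) * exp (- \<kappa>4 * (dist x y)\<^sup>2 / t)"
    using heat_kernel_bound unfolding heat_def by blast
  \<comment> \<open>The same exponent as in \<open>heat_error_tendsto\<close>, where it makes the
    near term decay like X powr (-1/4) for X = 1/t; the cut-off radius is X powr (\<epsilon> -
    1/2).\<close>
  define \<epsilon> where "\<epsilon> = 1 / (4 * (q + 1))"
  define e where "e = (\<lambda>n::nat. K * (real (Suc n) powr (\<epsilon> - 1 / 2)) * (\<kappa>3 * real (Suc n) powr (q / 2)) *
            (\<kappa>2 * (real (Suc n) powr (\<epsilon> - 1 / 2)) powr q) +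
          2 * (\<kappa>3 * real (Suc n) powr (q / 2) * exp (- \<kappa>4 * real (Suc n) powr (2 * \<epsilon>))))"
  show thesis
  proof (rule that[of e])
    show "e \<longlonglongrightarrow> 0"
      unfolding e_def \<epsilon>_def by (rule heat_error_tendsto[OF q_pos \<kappa>(2)])
    fix n x
    define X where "X = real (Suc n)"
    have X: "X > 0" "X \<ge> 1" by (auto simp: X_def)
    have b: "\<bar>heat (1 / X) x y\<bar> \<le> \<kappa>3 * X powr (q / 2) * exp (- \<kappa>4 * ((dist x y)\<^sup>2 * X))" for x y
      using \<kappa>(3)[of "1 / X" x y] X by (simp add: powr_divide powr_minus field_simps)
    have b1: "\<bar>heat (1 / X) x y\<bar> \<le> \<kappa>3 * X powr (q / 2)" for x y
      by (rule order_trans[OF b mult_left_le]) (use \<kappa>(1,2) X in auto)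
    have b2: "\<bar>heat (1 / X) x y\<bar> \<le> \<kappa>3 * X powr (q / 2) * exp (- \<kappa>4 * X powr (2 * \<epsilon>))"
      if "X powr (\<epsilon> - 1 / 2) \<le> dist x y" for x y
    proof -
      \<comment> \<open>The Gaussian exponent at the cut-off radius r: r^2 / t is X powr (2 *
        \<epsilon>).\<close>
      have "X powr (2 * \<epsilon>) = (X powr (\<epsilon> - 1 / 2))\<^sup>2 * X"
      proof -
        have "(X powr (\<epsilon> - 1 / 2))\<^sup>2 * X = X powr (2 * (\<epsilon> - 1 / 2)) * X powr 1"
          using X by (simp add: powr_power mult.commute)
        also have "\<dots> = X powr (2 * \<epsilon>)" unfolding powr_add [symmetric] by (simp add: right_diff_distrib)
        finally show ?thesis by simp
      qed
      also have "\<dots> \<le> (dist x y)\<^sup>2 * X"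
        using X that by (intro mult_right_mono power_mono) auto
      finally show ?thesis
        using \<kappa> X by (intro order_trans[OF b] mult_left_mono) auto
    qed
    show "\<bar>(LINT y|M. g y * heat (1 / real (Suc n)) x y) - g x\<bar> \<le> e n"
      unfolding e_def X_def[symmetric]
      using X \<kappa>(1) \<kappa>2(1) by (intro heat_approx b1 b2 \<kappa>2(2) g lip K) auto
  qed
qed

lemma heat_bounded: "\<exists>\<kappa>>0. \<forall>t>0. t \<le> 1 \<longrightarrow> (\<forall>x y. \<bar>heat t x y\<bar> \<le> \<kappa> * t powr (- q / 2))"
proof -
  obtain \<kappa>3 \<kappa>4 where \<kappa>: "\<kappa>3 > 0" "\<kappa>4 > 0" "\<And>t x y. 0 < t \<Longrightarrow> t \<le> 1 \<Longrightarrow>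
      \<bar>heat t x y\<bar> \<le> \<kappa>3 * t powr (- q / 2) * exp (- \<kappa>4 * (dist x y)\<^sup>2 / t)"
    using heat_kernel_bound unfolding heat_def by blast
  have "\<bar>heat t x y\<bar> \<le> \<kappa>3 * t powr (- q / 2)" if t: "0 < t" "t \<le> 1" for t x y
    by (rule order_trans[OF \<kappa>(3)[OF t] mult_left_le]) (use \<kappa>(1,2) t in auto)
  then show ?thesis using \<kappa>(1) by blast
qed

text \<open>Heat smoothing turns \<open>g\<close> into a function \<open>T\<close> with a pointwise
  expansion in the \<open>phi k\<close>. Integrated term by term against \<open>f\<close>, it gives
  0, so only the integral of f (g - T) is left, at most the uniform error times the L1 norm of
  \<open>f\<close>.\<close>

lemma orthogonal_lipschitz:
  assumes f: "f \<in> Lp_space 2 M" "\<And>k. fcoeff f k = 0"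
    and g: "continuous_on UNIV g" "\<And>x. \<bar>g x\<bar> \<le> 1"
    and lip: "\<And>x y. \<bar>g x - g y\<bar> \<le> K * dist x y" and K: "0 \<le> K"
  shows "(LINT x|M. f x * complex_of_real (g x)) = 0"
proof -
  have fi: "integrable M f" using f by (intro Lp_space_2_integrable)
  have [measurable]: "g \<in> borel_measurable M"
    using g by (intro borel_measurable_imp borel_measurable_continuous_onI)
  have gi: "integrable M g" by (rule integrable_bounded[where B = 1]) (auto simp: g)
  obtain e where e: "e \<longlonglongrightarrow> 0"
    "\<And>n x. \<bar>(LINT y|M. g y * heat (1 / real (Suc n)) x y) - g x\<bar> \<le> e n"
    using heat_approx_uniform[OF g lip K] by blast
  have "norm (LINT x|M. f x * complex_of_real (g x)) \<le> e n * (LINT x|M. norm (f x))" for n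
  proof -
    define t where "t = 1 / real (Suc n)"
    have t: "0 < t" "t \<le> 1" by (auto simp: t_def)
    obtain B where B: "\<And>x y. \<bar>heat t x y\<bar> \<le> B" using heat_bounded t by blast
    define T where "T = (\<lambda>x. LINT y|M. g y * heat t x y)"
    define w where "w = (\<lambda>k. exp (- ((lam k)\<^sup>2 * t)) * (LINT y|M. g y * phi k y))"
    have T: "(\<lambda>k. w k * phi k x) sums T x" for x
      using heat_integral[OF t B gi, of x] by (simp add: T_def w_def mult_ac)
    have "(\<lambda>x. \<Sum>k. w k * phi k x) \<in> borel_measurable M" by measurable
    then have Tm [measurable]: "T \<in> borel_measurable M" unfolding sums_unique[OF T, symmetric] .
    \<comment> \<open>A partial sum of the expansion of \<open>T\<close> is the integral of
      \<open>g\<close> against the truncated kernel \<open>z\<close>, which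
      \<open>heat_partial_sum\<close> bounds. The bound may depend on t, which is fixed
      here.\<close>
    have bnd: "\<bar>\<Sum>k<n. w k * phi k x\<bar> \<le> B" for n x
    proof -
      define z where "z = (\<lambda>y. \<Sum>k<n. exp (- ((lam k)\<^sup>2 * t)) * phi k x * phi k y)"
      have zB: "\<bar>z y\<bar> \<le> B" for y
        using heat_partial_sum[OF t B] by (simp add: z_def)
      have igp: "integrable M (\<lambda>y. g y * phi k y)" for k
        using integrable_phi_mult[OF gi, of k] by simp
      have "(\<Sum>k<n. w k * phi k x) = (\<Sum>k<n. LINT y|M. exp (- ((lam k)\<^sup>2 * t)) * phi k x * (g y * phi k y))"
        unfolding integral_mult_right_zero by (simp add: w_def mult_ac)
      also have "\<dots> = (LINT y|M. (\<Sum>k<n. exp (- ((lam k)\<^sup>2 * t)) * phi k x * (g y * phi k y)))"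
        using igp by (subst Bochner_Integration.integral_sum) auto
      also have "\<dots> = (LINT y|M. g y * z y)"
        by (simp add: z_def sum_distrib_left mult_ac)
      also have "\<bar>\<dots>\<bar> \<le> (LINT y|M. \<bar>g y * z y\<bar>)"
        using integral_norm_bound[of M "\<lambda>y. g y * z y"] by simp
      also have "\<dots> \<le> (LINT y|M. B)"
      proof (rule integral_mono)
        have [measurable]: "z \<in> borel_measurable M" unfolding z_def by measurable
        have *: "\<bar>g y * z y\<bar> \<le> B" for y
          using mult_mono[OF g(2)[of y] zB[of y]] by (simp add: abs_mult)
        then show "integrable M (\<lambda>y. \<bar>g y * z y\<bar>)" by (intro integrable_bounded[where B = B]) auto
        show "\<bar>g y * z y\<bar> \<le> B" for y by (rule *)
      qed simp
      also have "\<dots> = B" by (simp add: space_eq_UNIV measure_UNIV)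
      finally show ?thesis .
    qed
    have Tc: "(\<lambda>k. complex_of_real (w k) * of_real (phi k x)) sums complex_of_real (T x)" for x
      using T[of x] by (simp add: sums_of_real flip: of_real_mult)
    have "norm (\<Sum>k<n. complex_of_real (w k) * of_real (phi k x)) \<le> B" for n x
      using bnd[of x n] by (simp flip: of_real_mult of_real_sum)
    from series_integral[OF this sums_summable[OF Tc] fi]
    have "(LINT x|M. f x * complex_of_real (T x)) = 0"
      using f(2) sums_unique[OF Tc] by (simp add: fourier_coeff_def sums_iff)
    moreover have "integrable M (\<lambda>x. f x * complex_of_real (g x))"
      by (rule integrable_mult_bounded[OF fi, where B = 1]) (auto simp: g)
    moreover have Te: "\<bar>T x - g x\<bar> \<le> e n" for x
      using e(2)[where n = n] by (simp add: T_def t_def)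
    have Tb: "norm (complex_of_real (T x)) \<le> e n + 1" for x
    proof -
      have "\<bar>T x\<bar> \<le> e n + 1" using Te[of x] g(2)[of x] by linarith
      then show ?thesis by simp
    qed
    moreover have "integrable M (\<lambda>x. f x * complex_of_real (T x))"
      by (rule integrable_mult_bounded[OF fi _ Tb]) auto
    ultimately have "(LINT x|M. f x * complex_of_real (g x)) = (LINT x|M. f x * complex_of_real (g x - T x))"
      by (simp add: right_diff_distrib)
    also have "norm \<dots> \<le> (LINT x|M. norm (f x * complex_of_real (g x - T x)))"
      by (rule integral_norm_bound)
    also have "\<dots> \<le> (LINT x|M. e n * norm (f x))"
    proof (rule integral_mono)
      show "norm (f x * complex_of_real (g x - T x)) \<le> e n * norm (f x)" for x
        using mult_right_mono[OF Te[of x] norm_ge_zero[of "f x"]]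
        by (simp add: norm_mult mult.commute abs_minus_commute flip: of_real_diff)
      have "norm (complex_of_real (g x - T x)) \<le> e n" for x
        using Te[of x] by (simp add: abs_minus_commute flip: of_real_diff)
      then show "integrable M (\<lambda>x. norm (f x * complex_of_real (g x - T x)))"
        by (intro integrable_norm integrable_mult_bounded[OF fi]) auto
      show "integrable M (\<lambda>x. e n * norm (f x))" using fi by auto
    qed
    finally show ?thesis by simp
  qed
  moreover have "(\<lambda>n. e n * (LINT x|M. norm (f x))) \<longlonglongrightarrow> 0 * (LINT x|M. norm (f x))"
    by (intro tendsto_mult_right e)
  ultimately have "norm (LINT x|M. f x * complex_of_real (g x)) \<le> 0"
    by (intro LIMSEQ_le_const[where X = "\<lambda>n. e n * (LINT x|M. norm (f x))"]) auto
  then show ?thesis by simp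
qed

text \<open>Tents of slope n around A tend pointwise to its indicator. Their Lipschitz constants may
  grow, since orthogonality to each of them is exact.\<close>

lemma orthogonal_closed:
  assumes f: "f \<in> Lp_space 2 M" "\<And>k. fcoeff f k = 0" and A: "closed A"
  shows "set_lebesgue_integral M A f = 0"
proof (cases "A = {}")
  \<comment> \<open>\<open>infdist\<close> to the empty set is 0 by convention, so the tents would
    not tend to its indicator.\<close>
  case True
  then show ?thesis by (simp add: set_lebesgue_integral_def)
next
  case False
  have fi: "integrable M f" using f by (intro Lp_space_2_integrable)
  have [measurable]: "f \<in> borel_measurable M" "A \<in> sets M" using fi A borel_sets_imp by auto
  define g where "g = (\<lambda>n y. max 0 (1 - real n * infdist y A))"
  have gc: "continuous_on UNIV (g n)" for n
    unfolding g_def by (intro continuous_intros)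
  then have [measurable]: "g n \<in> borel_measurable M" for n
    by (intro borel_measurable_imp borel_measurable_continuous_onI)
  have gb: "\<bar>g n y\<bar> \<le> 1" for n y
    using infdist_nonneg[of y A] by (simp add: g_def)
  have lip: "\<bar>g n x - g n y\<bar> \<le> real n * dist x y" for n x y
  proof -
    have "\<bar>g n x - g n y\<bar> \<le> \<bar>real n * infdist x A - real n * infdist y A\<bar>"
      by (simp add: g_def max_def abs_minus_commute)
    also have "\<dots> = real n * \<bar>infdist x A - infdist y A\<bar>"
      by (simp add: abs_mult flip: right_diff_distrib)
    also have "\<dots> \<le> real n * dist x y"
      by (intro mult_left_mono infdist_triangle_abs) auto
    finally show ?thesis .
  qed
  have "(\<lambda>n. g n y) \<longlonglongrightarrow> indicator A y" for y
  proof (cases "y \<in> A")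
    case True
    then show ?thesis by (simp add: g_def)
  next
    case False
    then have "infdist y A > 0" using infdist_pos_not_in_closed[OF A \<open>A \<noteq> {}\<close>] by simp
    then have "filterlim (\<lambda>n. real n * infdist y A) at_top sequentially"
      by (intro filterlim_at_top_mult_tendsto_pos[OF tendsto_const] filterlim_real_sequentially)
    then have "eventually (\<lambda>n. 1 \<le> real n * infdist y A) sequentially"
      by (simp add: filterlim_at_top)
    then have "eventually (\<lambda>n. g n y = 0) sequentially"
      by eventually_elim (simp add: g_def)
    then show ?thesis using False by (simp add: tendsto_eventually)
  qed
  then have lim: "(\<lambda>n. f y * complex_of_real (g n y)) \<longlonglongrightarrow> f y * complex_of_real (indicator A y)" for y
    by (intro tendsto_intros)
  have "(\<lambda>n. LINT y|M. f y * complex_of_real (g n y)) \<longlonglongrightarrow> (LINT y|M. f y * complex_of_real (indicator A y))"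
  proof (rule integral_dominated_convergence[where w = "\<lambda>y. norm (f y)"])
    show "AE y in M. norm (f y * complex_of_real (g n y)) \<le> norm (f y)" for n
      using gb[of n] by (intro AE_I2) (simp add: norm_mult mult_left_le)
    show "integrable M (\<lambda>y. norm (f y))" using fi by auto
  qed (use lim in auto)
  moreover have "(LINT y|M. f y * complex_of_real (g n y)) = 0" for n
    by (rule orthogonal_lipschitz[OF f gc gb lip]) simp
  ultimately have "(LINT y|M. f y * complex_of_real (indicator A y)) = 0"
    by (simp add: LIMSEQ_const_iff)
  then show ?thesis
    by (simp add: set_lebesgue_integral_def scaleR_conv_of_real mult.commute)
qed

text \<open>Closed sets are stable under intersection and generate the Borel sets, so vanishing of
  the integral of f over closed sets extends to all Borel sets, then to the completion. An
  integrable function whose integral over every measurable set vanishes is zero almost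
  everywhere.\<close>

lemma phi_complete:
  assumes f: "f \<in> Lp_space 2 M" "\<And>k. fcoeff f k = 0"
  shows "AE x in M. f x = 0"
proof -
  have fi: "integrable M f" using f by (intro Lp_space_2_integrable)
  have si: "set_integrable M A f" if "A \<in> sets M" for A
    using fi that by (simp add: set_integrable_def integrable_mult_indicator)
  \<comment> \<open>The coefficient of the constant function; it settles complements in the
    induction below.\<close>
  have total: "(LINT x|M. f x) = 0" using f(2)[of 0] by (simp add: fourier_coeff_def phi_0)
  have borel: "A \<in> sets borel \<and> set_lebesgue_integral M A f = 0"
    if "A \<in> sigma_sets UNIV (Collect closed)" for A
  proof -
    have sb: "sigma_sets UNIV (Collect closed) = sets (borel :: 'a measure)"
      by (simp add: borel_eq_closed)
    have "Int_stable (Collect closed :: 'a set set)" by (auto simp: Int_stable_def)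
    moreover have "Collect closed \<subseteq> Pow (UNIV :: 'a set)" by simp
    ultimately have "set_lebesgue_integral M A f = 0"
      using that
    proof (induction rule: sigma_sets_induct_disjoint)
      case (basic A)
      then show ?case using orthogonal_closed[OF f] by auto
    next
      case empty
      show ?case by (simp add: set_lebesgue_integral_def)
    next
      case (compl A)
      then have A: "A \<in> sets M" using sb borel_sets_imp by auto
      have "(\<lambda>x. indicator (UNIV - A) x *\<^sub>R f x) = (\<lambda>x. f x - indicator A x *\<^sub>R f x)"
        by (auto simp: indicator_def fun_eq_iff)
      then show ?case
        using compl(2) si[OF A] fi total by (simp add: set_lebesgue_integral_def set_integrable_def)
    next
      case (union A)
      then have A: "A i \<in> sets M" for i using sb borel_sets_imp by auto
      then have "set_lebesgue_integral M (\<Union>i. A i) f = (\<Sum>i. set_lebesgue_integral M (A i) f)"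
        using union(1) by (intro lebesgue_integral_countable_add si)
          (auto simp: disjoint_family_on_def)
      then show ?case using union by simp
    qed
    then show ?thesis using that sb by auto
  qed
  \<comment> \<open>A set of the completion is a Borel set up to a part of a null set, which does
    not affect the integral.\<close>
  obtain N where N: "sets N = sets borel" "M = completion N" using complete_borel by blast
  have "set_lebesgue_integral M A f = 0" if "A \<in> sets M" for A
  proof -
    have "A \<in> sets (completion N)" using that N by simp
    then obtain S Z Z' where SZ: "A = S \<union> Z" "Z \<subseteq> Z'" "Z' \<in> null_sets N" "S \<in> sets N"
      by (rule sets_completionE)
    have "AE x in M. x \<notin> Z'"
      using SZ(3) N(2) by (auto intro: AE_not_in null_sets_completionI)
    then have "AE x in M. indicator A x *\<^sub>R f x = indicator S x *\<^sub>R f x"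
      by eventually_elim (use SZ(1,2) in \<open>auto simp: indicator_def\<close>)
    moreover have "S \<in> sets M" using SZ(4) N(1) borel_sets_imp by auto
    ultimately have "set_lebesgue_integral M A f = set_lebesgue_integral M S f"
      using si[OF that] si[of S] unfolding set_lebesgue_integral_def set_integrable_def
      by (intro integral_cong_AE) auto
    then show ?thesis using borel[of S] SZ(4) N(1) by (simp add: borel_eq_closed)
  qed
  then show ?thesis by (rule prob.density_zero[OF fi])
qed

section \<open>Riesz-Fischer and Parseval\<close>

text \<open>Partial sums are Cauchy in L2, hence in L1, so a subsequence converges almost
  everywhere; Fatou turns the L2 estimates between partial sums into the stated one for the limit.
  That estimate at n = 0 bounds the norm of \<open>h\<close> and is the missing half of
  Parseval.\<close>

lemma riesz_fischer:
  assumes c: "sqsum c"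
  obtains h where "h \<in> Lp_space 2 M" "\<And>k. fcoeff h k = c k"
    "\<And>n. (LINT x|M. (norm (h x - fourier_sum c {..<n} x))\<^sup>2) \<le> (\<Sum>k. (norm (c k))\<^sup>2) - (\<Sum>k<n. (norm (c k))\<^sup>2)"
proof -
  define s where "s = (\<lambda>n. fourier_sum c {..<n})"
  define T where "T = (\<lambda>n. (\<Sum>k. (norm (c k))\<^sup>2) - (\<Sum>k<n. (norm (c k))\<^sup>2))"
  have sL: "s n \<in> Lp_space 2 M" for n by (simp add: s_def fourier_sum_Lp)
  have [measurable]: "s n \<in> borel_measurable M" for n using sL[of n] by (simp add: Lp_space_2)
  have T: "T \<longlonglongrightarrow> 0"
    using summable_LIMSEQ[of "\<lambda>k. (norm (c k))\<^sup>2"] c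
    unfolding T_def sqsum_def by (auto intro!: tendsto_eq_intros)
  have diff: "(LINT x|M. (norm (s m x - s n x))\<^sup>2) \<le> T n" if "n \<le> m" for m n
  proof -
    have "s m x - s n x = fourier_sum c {n..<m} x" for x
      using that unfolding s_def fourier_sum_def by (simp add: sum_diff_nat_ivl lessThan_atLeast0)
    then have "(LINT x|M. (norm (s m x - s n x))\<^sup>2) = (\<Sum>k=n..<m. (norm (c k))\<^sup>2)"
      by (simp add: norm_fourier_sum)
    also have "\<dots> = (\<Sum>k<m. (norm (c k))\<^sup>2) - (\<Sum>k<n. (norm (c k))\<^sup>2)"
      using that by (simp add: sum_diff_nat_ivl lessThan_atLeast0)
    also have "\<dots> \<le> T n"
      using c unfolding T_def sqsum_def by (intro diff_right_mono sum_le_suminf) auto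
    finally show ?thesis .
  qed
  have cauchy: "\<exists>N. \<forall>i\<ge>N. \<forall>j\<ge>N. (LINT x|M. norm (s i x - s j x)) < e" if e: "e > 0" for e
  proof -
    from T have "eventually (\<lambda>n. T n < e\<^sup>2) sequentially"
      by (rule order_tendstoD) (use e in auto)
    then obtain N where N: "\<And>n. n \<ge> N \<Longrightarrow> T n < e\<^sup>2" by (auto simp: eventually_sequentially)
    have *: "(LINT x|M. norm (s i x - s j x)) < e" if "j \<ge> N" "i \<ge> j" for i j
    proof -
      have "(LINT x|M. norm (s i x - s j x))\<^sup>2 \<le> (LINT x|M. (norm (s i x - s j x))\<^sup>2)"
        by (intro L1_le_L2 Lp_space_2_diff sL)
      also have "\<dots> < e\<^sup>2" using diff[OF that(2)] N[OF that(1)] by simp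
      finally show ?thesis by (rule power_less_imp_less_base) (use e in simp)
    qed
    show ?thesis
    proof (intro exI allI impI)
      fix i j assume "N \<le> i" "N \<le> j"
      then show "(LINT x|M. norm (s i x - s j x)) < e"
        using *[of i j] *[of j i] by (cases "i \<le> j") (auto simp: norm_minus_commute)
    qed
  qed
  obtain r where r: "strict_mono r" "AE x in M. Cauchy (\<lambda>i. s (r i) x)"
    using cauchy_L1_AE_cauchy_subseq[of M s, OF Lp_space_2_integrable[OF sL] cauchy] by metis
  define h where "h = (\<lambda>x. lim (\<lambda>i. s (r i) x))"
  have hm [measurable]: "h \<in> borel_measurable M" unfolding h_def by measurable
  have lim: "AE x in M. (\<lambda>i. s (r i) x) \<longlonglongrightarrow> h x"
    using r(2) unfolding h_def Cauchy_convergent_iff convergent_LIMSEQ_iff .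
  \<comment> \<open>Fatou along the subsequence, with n fixed: once i \<ge> n also r i \<ge> n, and
    \<open>diff\<close> applies.\<close>
  have nn: "(\<integral>\<^sup>+x. ennreal ((norm (h x - s n x))\<^sup>2) \<partial>M) \<le> ennreal (T n)" for n
  proof -
    have "(\<integral>\<^sup>+x. ennreal ((norm (h x - s n x))\<^sup>2) \<partial>M)
       = (\<integral>\<^sup>+x. liminf (\<lambda>i. ennreal ((norm (s (r i) x - s n x))\<^sup>2)) \<partial>M)"
    proof (rule nn_integral_cong_AE)
      show "AE x in M. ennreal ((norm (h x - s n x))\<^sup>2)
          = liminf (\<lambda>i. ennreal ((norm (s (r i) x - s n x))\<^sup>2))"
        using lim
      proof eventually_elim
        case (elim x)
        then have "(\<lambda>i. ennreal ((norm (s (r i) x - s n x))\<^sup>2)) \<longlonglongrightarrow> ennreal ((norm (h x - s n x))\<^sup>2)"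
          by (intro tendsto_intros)
        from lim_imp_Liminf[OF _ this] show ?case by simp
      qed
    qed
    also have "\<dots> \<le> liminf (\<lambda>i. \<integral>\<^sup>+x. ennreal ((norm (s (r i) x - s n x))\<^sup>2) \<partial>M)"
      by (rule nn_integral_liminf) measurable
    also have "\<dots> \<le> liminf (\<lambda>i::nat. ennreal (T n))"
    proof (rule Liminf_mono)
      have "(\<integral>\<^sup>+x. ennreal ((norm (s (r i) x - s n x))\<^sup>2) \<partial>M) \<le> ennreal (T n)" if "i \<ge> n" for i
      proof -
        have "n \<le> r i" using that seq_suble[OF r(1), of i] by simp
        then show ?thesis
          using diff[of n "r i"] Lp_space_2_diff[OF sL[of "r i"] sL[of n]]
          by (subst nn_integral_eq_integral) (auto simp: Lp_space_2 intro: ennreal_leI)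
      qed
      then show "\<forall>\<^sub>F i in sequentially. (\<integral>\<^sup>+x. ennreal ((norm (s (r i) x - s n x))\<^sup>2) \<partial>M) \<le> ennreal (T n)"
        by (auto simp: eventually_sequentially)
    qed
    also have "\<dots> = ennreal (T n)" by (simp add: Liminf_const)
    finally show ?thesis .
  qed
  have T0: "0 \<le> T n" for n
    using c unfolding T_def sqsum_def by (simp add: sum_le_suminf)
  have le: "(LINT x|M. (norm (h x - s n x))\<^sup>2) \<le> T n" for n
    by (rule integral_real_bounded[OF T0 nn])
  have "integrable M (\<lambda>x. (norm (h x - s n x))\<^sup>2)" for n
  proof (rule integrableI_bounded)
    show "(\<integral>\<^sup>+x. ennreal (norm ((norm (h x - s n x))\<^sup>2)) \<partial>M) < \<infinity>"
      using order_le_less_trans[OF nn[of n] ennreal_less_top] by simp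
  qed measurable
  then have dL: "(\<lambda>x. h x - s n x) \<in> Lp_space 2 M" for n by (simp add: Lp_space_2)
  have hL: "h \<in> Lp_space 2 M" using dL[of 0] by (simp add: s_def fourier_sum_def)
  have "fcoeff h k = c k" for k
  proof -
    obtain B where B: "\<And>x. \<bar>phi k x\<bar> \<le> B" using phi_bound by blast
    have B0: "0 \<le> B" using B[of undefined] by linarith
    \<comment> \<open>For n > k the partial sum already has \<open>c k\<close> as its coefficient,
      so the discrepancy is the coefficient of a remainder tending to 0 in L2.\<close>
    have "norm (fcoeff h k - c k) \<le> B * sqrt (T n)" if "n > k" for n
    proof -
      have di: "integrable M (\<lambda>x. h x - s n x)" using dL by (rule Lp_space_2_integrable)
      have "fcoeff h k - c k = fcoeff (\<lambda>x. h x - s n x) k"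
        using that by (subst fcoeff_diff[OF hL sL]) (simp add: s_def fcoeff_fourier_sum)
      also have "norm \<dots> \<le> (LINT x|M. norm ((h x - s n x) * complex_of_real (phi k x)))"
        unfolding fourier_coeff_def by (rule integral_norm_bound)
      also have "\<dots> \<le> (LINT x|M. B * norm (h x - s n x))"
      proof (rule integral_mono)
        show "integrable M (\<lambda>x. norm ((h x - s n x) * complex_of_real (phi k x)))"
          by (intro integrable_norm integrable_phi_mult di)
        show "integrable M (\<lambda>x. B * norm (h x - s n x))" using di by auto
        show "norm ((h x - s n x) * complex_of_real (phi k x)) \<le> B * norm (h x - s n x)" for x
          using mult_left_mono[OF B[of x] norm_ge_zero[of "h x - s n x"]]
          by (simp add: norm_mult mult.commute)
      qed
      also have "\<dots> = B * (LINT x|M. norm (h x - s n x))" by simp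
      also have "\<dots> \<le> B * sqrt (T n)"
        using L1_le_L2[OF dL[of n]] le[of n] B0 by (intro mult_left_mono real_le_rsqrt) auto
      finally show ?thesis .
    qed
    moreover have "(\<lambda>n. B * sqrt (T n)) \<longlonglongrightarrow> B * sqrt 0" by (intro tendsto_intros T)
    ultimately have "norm (fcoeff h k - c k) \<le> B * sqrt 0"
      by (intro LIMSEQ_le_const[where X = "\<lambda>n. B * sqrt (T n)"] exI[of _ "Suc k"]) auto
    then show ?thesis by simp
  qed
  then show thesis using that[of h] hL le by (simp add: s_def T_def)
qed

lemma bessel:
  assumes h: "h \<in> Lp_space 2 M"
  shows "(\<Sum>k<n. (norm (fcoeff h k))\<^sup>2) \<le> (LINT x|M. (norm (h x))\<^sup>2)"
proof -
  have "0 \<le> (LINT x|M. (norm (h x - fourier_sum (fcoeff h) {..<n} x))\<^sup>2)" by simp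
  then show ?thesis using bessel_identity[OF h, of n] by simp
qed

lemma sqsum_fcoeff: "h \<in> Lp_space 2 M \<Longrightarrow> sqsum (fcoeff h)"
  unfolding sqsum_def by (rule summableI_nonneg_bounded[OF _ bessel]) auto

text \<open>Bessel gives one inequality. For the other, Riesz-Fischer builds a function with the
  same coefficients and no larger norm than their square sum; completeness identifies it with
  \<open>h\<close> almost everywhere.\<close>

lemma parseval:
  assumes h: "h \<in> Lp_space 2 M"
  shows "(LINT x|M. (norm (h x))\<^sup>2) = (\<Sum>k. (norm (fcoeff h k))\<^sup>2)"
proof (rule antisym)
  show "(\<Sum>k. (norm (fcoeff h k))\<^sup>2) \<le> (LINT x|M. (norm (h x))\<^sup>2)"
    using sqsum_fcoeff[OF h] bessel[OF h] by (intro suminf_le_const) (auto simp: sqsum_def)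
  obtain h' where h': "h' \<in> Lp_space 2 M" "\<And>k. fcoeff h' k = fcoeff h k"
    "\<And>n. (LINT x|M. (norm (h' x - fourier_sum (fcoeff h) {..<n} x))\<^sup>2) \<le>
        (\<Sum>k. (norm (fcoeff h k))\<^sup>2) - (\<Sum>k<n. (norm (fcoeff h k))\<^sup>2)"
    using riesz_fischer[OF sqsum_fcoeff[OF h]] by blast
  have "AE x in M. h' x - h x = 0"
    by (rule phi_complete) (auto intro: Lp_space_2_diff h h' simp: fcoeff_diff h h')
  then have "(LINT x|M. (norm (h x))\<^sup>2) = (LINT x|M. (norm (h' x))\<^sup>2)"
    using h h' by (intro integral_cong_AE) (auto simp: Lp_space_2)
  also have "\<dots> \<le> (\<Sum>k. (norm (fcoeff h k))\<^sup>2)"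
    using h'(3)[of 0] by (simp add: fourier_sum_def)
  finally show "(LINT x|M. (norm (h x))\<^sup>2) \<le> (\<Sum>k. (norm (fcoeff h k))\<^sup>2)" .
qed

section \<open>Masks and the diagonal of the kernel\<close>

lemma lam_nonneg: "lam k \<ge> 0"
  using lam_mono lam_0 by (metis incseqD le0)

lemma mask_nonzero:
  assumes "is_mask q \<beta> b"
  shows "b (lam k) \<noteq> 0"
proof -
  obtain c c1 where "c1 > 0" "c1 * (1 + lam k) powr (- \<beta>) \<le> b (lam k)"
    using mask_bounds[OF assms] lam_nonneg by metis
  moreover have "0 < c1 * (1 + lam k) powr (- \<beta>)"
    using \<open>c1 > 0\<close> lam_nonneg[of k] by simp
  ultimately show ?thesis by linarith
qed

text \<open>
  The heat kernel at time \<open>4\<^sup>-\<^sup>m\<close> controls the eigenvalues with \<open>2\<^sup>m \<le> 1 + \<lambda> < 2\<^sup>m\<^sup>+\<^sup>1\<close>; the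
  dyadic blocks then sum to a geometric series of ratio \<open>2\<close> to the power \<open>q - 2 \<beta>\<close>.
\<close>

lemma weighted_diagonal_bounded:
  assumes \<beta>: "\<beta> > q / 2"
  shows "\<exists>B. \<forall>n x. (\<Sum>k<n. (1 + lam k) powr (- 2 * \<beta>) * (phi k x)\<^sup>2) \<le> B"
proof -
  obtain \<kappa> where \<kappa>: "\<kappa> > 0" "\<And>t x y. 0 < t \<Longrightarrow> t \<le> 1 \<Longrightarrow> \<bar>heat t x y\<bar> \<le> \<kappa> * t powr (- q / 2)"
    using heat_bounded by blast
  define \<rho> where "\<rho> = 2 powr (q - 2 * \<beta>)"
  have \<rho>: "0 < \<rho>" "\<rho> < 1"
    using \<beta> powr_less_mono[of "q - 2 * \<beta>" 0 2] by (auto simp: \<rho>_def)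
  define t where "t = (\<lambda>m::nat. 2 powr (- 2 * real m))"
  have t: "0 < t m" "t m \<le> 1" for m
    using powr_mono[of "- 2 * real m" 0 2] by (auto simp: t_def)
  \<comment> \<open>The factor exp 4 absorbs the heat damping within a dyadic block: there lam^2 t
    is at most 4^(m+1) 4^(-m) = 4.\<close>
  define block where "block = (\<lambda>m k. exp 4 * (2 powr (- 2 * \<beta> * real m) * exp (- ((lam k)\<^sup>2 * t m))))"
  have "\<exists>m. (1 + lam k) powr (- 2 * \<beta>) \<le> block m k" for k
  proof -
    define X where "X = 1 + lam k"
    have X: "X \<ge> 1" "0 \<le> lam k" "lam k \<le> X" using lam_nonneg[of k] by (auto simp: X_def)
    define m where "m = nat \<lfloor>log 2 X\<rfloor>"
    have "0 \<le> log 2 X" using X by simp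
    then have m: "real m \<le> log 2 X" "log 2 X < real m + 1"
      by (auto simp: m_def)
    have mX: "2 powr real m \<le> X" "X < 2 powr (real m + 1)"
      using m X by (auto simp: le_log_iff log_less_iff)
    have "X powr (- 2 * \<beta>) \<le> (2 powr real m) powr (- 2 * \<beta>)"
      using mX \<beta> q_pos by (intro powr_mono2') auto
    also have "\<dots> = 2 powr (- 2 * \<beta> * real m)" by (simp add: powr_powr mult.commute)
    finally have 1: "X powr (- 2 * \<beta>) \<le> 2 powr (- 2 * \<beta> * real m)" .
    have "(lam k)\<^sup>2 \<le> (2 powr (real m + 1))\<^sup>2" using X mX by (intro power_mono) auto
    then have "(lam k)\<^sup>2 * t m \<le> (2 powr (real m + 1))\<^sup>2 * t m"
      using t[of m] by (intro mult_right_mono) auto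
    also have "(2 powr (real m + 1))\<^sup>2 * t m = 2 powr (2 * (real m + 1) + (- 2 * real m))"
      unfolding t_def powr_add by (simp add: power2_eq_square flip: powr_add)
    also have "\<dots> = 4" by simp
    finally have "1 \<le> exp 4 * exp (- ((lam k)\<^sup>2 * t m))" by (simp flip: exp_add)
    then have "X powr (- 2 * \<beta>) * 1 \<le> 2 powr (- 2 * \<beta> * real m) * (exp 4 * exp (- ((lam k)\<^sup>2 * t m)))"
      using 1 by (intro mult_mono) auto
    then show ?thesis unfolding block_def X_def by (intro exI[of _ m]) (simp add: mult_ac)
  qed
  then obtain m where m: "\<And>k. (1 + lam k) powr (- 2 * \<beta>) \<le> block (m k) k" by metis
  have block_nonneg: "0 \<le> block m k" for m k by (simp add: block_def)
  have "(\<Sum>k<n. (1 + lam k) powr (- 2 * \<beta>) * (phi k x)\<^sup>2) \<le> exp 4 * \<kappa> * (1 / (1 - \<rho>))" for n x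
  proof -
    \<comment> \<open>A range containing the blocks of all k < n. Charging every k to every block
      below \<open>N\<close> overcounts harmlessly and makes the two sums interchangeable.\<close>
    define N where "N = Suc (\<Sum>k<n. m k)"
    have mN: "m k < N" if "k < n" for k
      using member_le_sum[of k "{..<n}" m] that by (simp add: N_def)
    have "(\<Sum>k<n. (1 + lam k) powr (- 2 * \<beta>) * (phi k x)\<^sup>2)
        \<le> (\<Sum>k<n. (\<Sum>j<N. block j k) * (phi k x)\<^sup>2)"
    proof (intro sum_mono mult_right_mono)
      fix k assume "k \<in> {..<n}"
      then have "block (m k) k \<le> (\<Sum>j<N. block j k)"
        using mN block_nonneg by (intro member_le_sum) auto
      then show "(1 + lam k) powr (- 2 * \<beta>) \<le> (\<Sum>j<N. block j k)" using m[of k] by linarith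
    qed auto
    also have "\<dots> = (\<Sum>j<N. exp 4 * (2 powr (- 2 * \<beta> * real j) * (\<Sum>k<n. exp (- ((lam k)\<^sup>2 * t j)) * (phi k x)\<^sup>2)))"
      unfolding block_def sum_distrib_left sum_distrib_right by (subst sum.swap) (simp add: mult_ac)
    also have "\<dots> \<le> (\<Sum>j<N. exp 4 * (2 powr (- 2 * \<beta> * real j) * (\<kappa> * t j powr (- q / 2))))"
      by (intro sum_mono mult_left_mono heat_diag t \<kappa>(2)) auto
    also have "\<dots> = (\<Sum>j<N. exp 4 * \<kappa> * \<rho> ^ j)"
    proof (intro sum.cong refl)
      fix j
      have "2 powr (- 2 * \<beta> * real j) * t j powr (- q / 2) = 2 powr (- 2 * \<beta> * real j + (- 2 * real j) * (- q / 2))"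
        by (simp only: t_def powr_powr powr_add)
      also have "\<dots> = 2 powr ((q - 2 * \<beta>) * real j)" by (simp add: algebra_simps)
      also have "\<dots> = \<rho> ^ j" by (simp add: \<rho>_def powr_power mult.commute)
      finally show "exp 4 * (2 powr (- 2 * \<beta> * real j) * (\<kappa> * t j powr (- q / 2))) = exp 4 * \<kappa> * \<rho> ^ j"
        by simp
    qed
    also have "\<dots> = exp 4 * \<kappa> * (\<Sum>j<N. \<rho> ^ j)" by (simp add: sum_distrib_left)
    also have "\<dots> \<le> exp 4 * \<kappa> * (1 / (1 - \<rho>))"
    proof (intro mult_left_mono)
      have "(\<Sum>j<N. \<rho> ^ j) \<le> (\<Sum>j. \<rho> ^ j)"
        using \<rho> by (intro sum_le_suminf summable_geometric) auto
      then show "(\<Sum>j<N. \<rho> ^ j) \<le> 1 / (1 - \<rho>)" using \<rho> by (simp add: suminf_geometric)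
    qed (use \<kappa> in auto)
    finally show ?thesis .
  qed
  then show ?thesis by blast
qed

lemma mask_diagonal_bounded:
  assumes "is_mask q \<beta> b" "\<beta> > q / 2"
  shows "\<exists>B. \<forall>n x. (\<Sum>k<n. (b (lam k))\<^sup>2 * (phi k x)\<^sup>2) \<le> B"
proof -
  obtain c c1 where c: "c > 0" "c1 > 0"
    "\<And>t. t \<ge> 0 \<Longrightarrow> c1 * (1 + t) powr (- \<beta>) \<le> b t \<and> b t \<le> c * (1 + t) powr (- \<beta>)"
    using mask_bounds[OF assms(1)] by blast
  obtain B where B: "\<And>n x. (\<Sum>k<n. (1 + lam k) powr (- 2 * \<beta>) * (phi k x)\<^sup>2) \<le> B"
    using weighted_diagonal_bounded[OF assms(2)] by blast
  have "(b (lam k))\<^sup>2 \<le> c\<^sup>2 * (1 + lam k) powr (- 2 * \<beta>)" for k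
  proof -
    \<comment> \<open>Squaring the upper bound is legitimate because the lower one makes
      \<open>b (lam k)\<close> nonnegative.\<close>
    have "0 \<le> c1 * (1 + lam k) powr (- \<beta>)" using c(2) by simp
    then have "(b (lam k))\<^sup>2 \<le> (c * (1 + lam k) powr (- \<beta>))\<^sup>2"
      using c(3)[OF lam_nonneg, of k] by (intro power_mono) linarith+
    also have "\<dots> = c\<^sup>2 * (1 + lam k) powr (- 2 * \<beta>)"
      using lam_nonneg[of k] by (simp add: power_mult_distrib powr_power)
    finally show ?thesis .
  qed
  then have "(\<Sum>k<n. (b (lam k))\<^sup>2 * (phi k x)\<^sup>2)
      \<le> (\<Sum>k<n. c\<^sup>2 * (1 + lam k) powr (- 2 * \<beta>) * (phi k x)\<^sup>2)" for n x
    by (intro sum_mono mult_right_mono) auto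
  also have "\<dots> n x = c\<^sup>2 * (\<Sum>k<n. (1 + lam k) powr (- 2 * \<beta>) * (phi k x)\<^sup>2)" for n x
    by (simp add: sum_distrib_left mult.assoc)
  also have "\<dots> n x \<le> c\<^sup>2 * B" for n x by (intro mult_left_mono B) auto
  finally show ?thesis by blast
qed

end

section \<open>The Sobolev class\<close>

text \<open>These two consequences of the mask hypotheses carry the rest of the argument: the first
  makes division by \<open>b (lam k)\<close> possible, the second makes synthesis converge uniformly
  bounded in x.\<close>

locale sobolev_space = data_defined_space +
  fixes b :: "real \<Rightarrow> real" and B :: real
  assumes b_nonzero: "b (lam k) \<noteq> 0"
    and diagonal_bounded: "(\<Sum>k<n. (b (lam k))\<^sup>2 * (phi k x)\<^sup>2) \<le> B"
begin

abbreviation "W \<equiv> sobolev 2 M lam phi b"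

definition wcoeff :: "('a \<Rightarrow> complex) \<Rightarrow> nat \<Rightarrow> complex" where
  "wcoeff g k = fcoeff g k / complex_of_real (b (lam k))"

lemma is_b_derivative_iff:
  "is_b_derivative 2 M lam phi b g h \<longleftrightarrow> h \<in> Lp_space 2 M \<and> (\<forall>k. fcoeff h k = wcoeff g k)"
  using b_nonzero by (auto simp: is_b_derivative_def wcoeff_def field_simps)

text \<open>Bessel in one direction; in the other, Riesz-Fischer constructs the b-derivative from
  its prescribed coefficients.\<close>

lemma W_iff: "g \<in> W \<longleftrightarrow> g \<in> Lp_space 2 M \<and> sqsum (wcoeff g)"
proof -
  have "(\<exists>h. is_b_derivative 2 M lam phi b g h) \<longleftrightarrow> sqsum (wcoeff g)"
  proof
    assume "\<exists>h. is_b_derivative 2 M lam phi b g h"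
    then obtain h where "h \<in> Lp_space 2 M" "fcoeff h = wcoeff g"
      unfolding is_b_derivative_iff by auto
    then show "sqsum (wcoeff g)" using sqsum_fcoeff by metis
  next
    assume "sqsum (wcoeff g)"
    then show "\<exists>h. is_b_derivative 2 M lam phi b g h"
      using riesz_fischer unfolding is_b_derivative_iff by metis
  qed
  then show ?thesis by (simp add: sobolev_def)
qed

text \<open>Whichever b-derivative the choice operator picks, its coefficients are
  \<open>wcoeff g\<close>, and Parseval computes its norm from them alone.\<close>

lemma sobolev_norm_eq:
  assumes "g \<in> W"
  shows "sobolev_norm 2 M lam phi b g = sqrt (\<Sum>k. (norm (wcoeff g k))\<^sup>2)"
proof -
  have "is_b_derivative 2 M lam phi b g (b_derivative 2 M lam phi b g)"
    using assms unfolding b_derivative_def sobolev_def by (simp add: someI_ex)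
  then show ?thesis
    unfolding sobolev_norm_def Lp_norm_2 is_b_derivative_iff by (simp add: parseval)
qed

lemma wcoeff_add: "f \<in> W \<Longrightarrow> g \<in> W \<Longrightarrow> wcoeff (\<lambda>x. f x + g x) k = wcoeff f k + wcoeff g k"
  by (simp add: W_iff wcoeff_def fcoeff_add add_divide_distrib)

lemma wcoeff_scale: "wcoeff (\<lambda>x. c * f x) k = c * wcoeff f k"
  by (simp add: wcoeff_def fcoeff_scale)

lemma W_add: "f \<in> W \<Longrightarrow> g \<in> W \<Longrightarrow> (\<lambda>x. f x + g x) \<in> W"
  using sqsum_add[of "wcoeff f" "wcoeff g"] ext[of "wcoeff (\<lambda>x. f x + g x)", OF wcoeff_add[of f g]]
  by (simp add: W_iff Lp_space_2_add)

lemma W_scale: "f \<in> W \<Longrightarrow> (\<lambda>x. c * f x) \<in> W"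
  using sqsum_scale[of "wcoeff f" c] ext[of "wcoeff (\<lambda>x. c * f x)", OF wcoeff_scale[of c f]]
  by (simp add: W_iff Lp_space_2_scale)

lemma W_zero: "(\<lambda>x. 0) \<in> W"
  by (simp add: W_iff Lp_space_2 wcoeff_def fourier_coeff_def sqsum_def)

text \<open>Stated for an abstract additive and homogeneous \<open>l\<close>, so that one induction
  serves both the coefficient maps and the evaluation functionals.\<close>

lemma W_linear_sum:
  fixes l :: "('a \<Rightarrow> complex) \<Rightarrow> complex"
  assumes add: "\<And>f g. f \<in> W \<Longrightarrow> g \<in> W \<Longrightarrow> l (\<lambda>x. f x + g x) = l f + l g"
    and scale: "\<And>f c. f \<in> W \<Longrightarrow> l (\<lambda>x. c * f x) = c * l f"
    and "finite A" "\<And>i. i \<in> A \<Longrightarrow> g i \<in> W"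
  shows "(\<lambda>x. \<Sum>i\<in>A. a i * g i x) \<in> W \<and> l (\<lambda>x. \<Sum>i\<in>A. a i * g i x) = (\<Sum>i\<in>A. a i * l (g i))"
  using assms(3,4)
proof (induction A rule: finite_induct)
  case empty
  then show ?case using scale[OF W_zero, of 0] W_zero by simp
next
  case (insert i A)
  have 1: "(\<lambda>x. a i * g i x) \<in> W" using insert.prems by (intro W_scale) simp
  have 2: "(\<lambda>x. \<Sum>i\<in>A. a i * g i x) \<in> W"
    "l (\<lambda>x. \<Sum>i\<in>A. a i * g i x) = (\<Sum>i\<in>A. a i * l (g i))"
    using insert.IH insert.prems by simp_all
  have 3: "l (\<lambda>x. a i * g i x) = a i * l (g i)" using insert.prems by (intro scale) simp
  show ?case
    using W_add[OF 1 2(1)] add[OF 1 2(1)] insert.hyps by (simp add: 2(2) 3)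
qed

lemma W_sum:
  assumes "finite A" "\<And>i. i \<in> A \<Longrightarrow> g i \<in> W"
  shows "(\<lambda>x. \<Sum>i\<in>A. a i * g i x) \<in> W"
    and "wcoeff (\<lambda>x. \<Sum>i\<in>A. a i * g i x) k = (\<Sum>i\<in>A. a i * wcoeff (g i) k)"
proof -
  have "(\<lambda>x. \<Sum>i\<in>A. a i * g i x) \<in> W \<and> wcoeff (\<lambda>x. \<Sum>i\<in>A. a i * g i x) k = (\<Sum>i\<in>A. a i * wcoeff (g i) k)"
    by (rule W_linear_sum[where l = "\<lambda>g. wcoeff g k"]) (auto intro: wcoeff_add wcoeff_scale assms)
  then show "(\<lambda>x. \<Sum>i\<in>A. a i * g i x) \<in> W"
    "wcoeff (\<lambda>x. \<Sum>i\<in>A. a i * g i x) k = (\<Sum>i\<in>A. a i * wcoeff (g i) k)" by simp_all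
qed

text \<open>These play two roles: as functions of the point they are the unit vectors in the
  \<open>wcoeff\<close> coordinates; at a fixed point, as a sequence in k, they are the coordinates
  of the kernel.\<close>

definition wphi :: "nat \<Rightarrow> 'a \<Rightarrow> complex" where
  "wphi k x = complex_of_real (b (lam k) * phi k x)"

lemma wcoeff_wphi: "wcoeff (wphi k) j = (if j = k then 1 else 0)"
  using fcoeff_scale[of "complex_of_real (b (lam k))" "\<lambda>x. complex_of_real (phi k x)" j] b_nonzero
  by (simp add: wphi_def[abs_def] wcoeff_def fcoeff_phi)

lemma sqsum_finite: "finite {k. c k \<noteq> 0} \<Longrightarrow> sqsum c"
  unfolding sqsum_def by (rule summable_finite) auto

lemma wphi_W: "wphi k \<in> W"
proof -
  have "sqsum (wcoeff (wphi k))" by (rule sqsum_finite) (simp add: wcoeff_wphi)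
  then show ?thesis
    using Lp_space_2_scale[OF phi_Lp, of "complex_of_real (b (lam k))" k]
    by (simp add: W_iff wphi_def[abs_def])
qed

lemma sqsum_wphi: "sqsum (\<lambda>k. wphi k x)"
  unfolding sqsum_def
  by (rule summableI_nonneg_bounded[where x = B])
    (use diagonal_bounded in \<open>auto simp: wphi_def power_mult_distrib norm_mult\<close>)

text \<open>The inverse of \<open>wcoeff\<close> as an honest pointwise sum rather than a limit in
  L2, so that identities with the kernel hold at every point.\<close>

definition synthesis :: "(nat \<Rightarrow> complex) \<Rightarrow> 'a \<Rightarrow> complex" where
  "synthesis d x = (\<Sum>k. d k * wphi k x)"

text \<open>Each term is at most |d k|^2 + |wphi k x|^2, so the partial sums are bounded uniformly
  in x by \<open>C\<close>; this gives membership in L2 and lets \<open>series_integral\<close> read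
  off the coefficients.\<close>

lemma synthesis_W:
  assumes d: "sqsum d"
  shows "synthesis d \<in> W" and "wcoeff (synthesis d) k = d k"
proof -
  define C where "C = (\<Sum>k. (norm (d k))\<^sup>2) + B"
  define w where "w = (\<lambda>k. d k * complex_of_real (b (lam k)))"
  have sm: "summable (\<lambda>k. w k * of_real (phi k x))" for x
    using summable_norm_cancel[OF sqsum_mult_summable[OF d sqsum_wphi[of x]]]
    by (simp add: wphi_def w_def mult.assoc)
  have synthesis: "synthesis d x = (\<Sum>k. w k * of_real (phi k x))" for x
    by (simp add: synthesis_def wphi_def w_def mult.assoc)
  have bnd: "norm (\<Sum>k<n. w k * of_real (phi k x)) \<le> C" for n x
  proof -
    have "norm (\<Sum>k<n. w k * of_real (phi k x)) \<le> (\<Sum>k<n. norm (w k * of_real (phi k x)))"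
      by (rule norm_sum)
    also have "\<dots> \<le> (\<Sum>k<n. (norm (d k))\<^sup>2 + (b (lam k))\<^sup>2 * (phi k x)\<^sup>2)"
    proof (intro sum_mono)
      fix k
      have "0 \<le> norm (d k) * \<bar>b (lam k) * phi k x\<bar>" by simp
      then have "norm (d k) * \<bar>b (lam k) * phi k x\<bar> \<le> (norm (d k))\<^sup>2 + \<bar>b (lam k) * phi k x\<bar>\<^sup>2"
        using sum_squares_bound[of "norm (d k)" "\<bar>b (lam k) * phi k x\<bar>"] by linarith
      then show "norm (w k * of_real (phi k x)) \<le> (norm (d k))\<^sup>2 + (b (lam k))\<^sup>2 * (phi k x)\<^sup>2"
        by (simp add: w_def norm_mult abs_mult power_mult_distrib mult.assoc)
    qed
    also have "\<dots> = (\<Sum>k<n. (norm (d k))\<^sup>2) + (\<Sum>k<n. (b (lam k))\<^sup>2 * (phi k x)\<^sup>2)"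
      by (simp add: sum.distrib)
    also have "\<dots> \<le> C"
      unfolding C_def using d diagonal_bounded by (intro add_mono sum_le_suminf) (auto simp: sqsum_def)
    finally show ?thesis .
  qed
  have "norm (synthesis d x) \<le> C" for x
    unfolding synthesis by (rule LIMSEQ_le_const2[OF tendsto_norm[OF summable_LIMSEQ[OF sm]]]) (use bnd in blast)
  moreover have "synthesis d \<in> borel_measurable M"
    unfolding synthesis[abs_def] by measurable
  ultimately have L: "synthesis d \<in> Lp_space 2 M" by (intro Lp_space_2_bounded)
  have wcoeff: "wcoeff (synthesis d) j = d j" for j
  proof -
    have "(LINT x|M. complex_of_real (phi j x) * of_real (phi k x)) = (if k = j then 1 else 0)" for k
      using fcoeff_phi[of j k] by (auto simp: fourier_coeff_def)
    then have "(\<lambda>k. w k * (LINT x|M. complex_of_real (phi j x) * of_real (phi k x)))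
        = (\<lambda>k. if k = j then w k else 0)"
      by (simp add: fun_eq_iff)
    then have "(\<lambda>k. if k = j then w k else 0) sums (LINT x|M. complex_of_real (phi j x) * synthesis d x)"
      using series_integral[OF bnd sm Lp_space_2_integrable[OF phi_Lp[of j]]]
      by (simp only: synthesis)
    then have "fcoeff (synthesis d) j = w j"
      using sums_single[of j w] by (auto simp: fourier_coeff_def mult.commute dest: sums_unique2)
    then show ?thesis using b_nonzero by (simp add: wcoeff_def w_def)
  qed
  show "wcoeff (synthesis d) k = d k" by (rule wcoeff)
  have "wcoeff (synthesis d) = d" using wcoeff by (rule ext)
  then show "synthesis d \<in> W" using L d by (simp add: W_iff)
qed

text \<open>The squared mask value splits into one factor for each variable; the diagonal bound
  gives convergence at every pair of points.\<close>

lemma kernel_eq_synthesis: "(\<lambda>u. complex_of_real (kernel_G lam phi b u x)) = synthesis (\<lambda>k. wphi k x)"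
proof
  fix u
  have "summable (\<lambda>k. (b (lam k))\<^sup>2 * phi k u * phi k x)"
    by (rule partial_sum_summable[OF _ diagonal_bounded]) auto
  then show "complex_of_real (kernel_G lam phi b u x) = synthesis (\<lambda>k. wphi k x) u"
    by (simp add: kernel_G_def synthesis_def wphi_def suminf_of_real power2_eq_square mult_ac)
qed

end

section \<open>Representers and minimal interpolation\<close>

text \<open>One constraint functional at a time: \<open>l\<close> stands for applying one operator
  and evaluating at one of the given points.\<close>

locale bounded_functional = sobolev_space +
  fixes l :: "('a \<Rightarrow> complex) \<Rightarrow> complex" and C :: real
  assumes l_add: "f \<in> W \<Longrightarrow> g \<in> W \<Longrightarrow> l (\<lambda>x. f x + g x) = l f + l g"
    and l_scale: "f \<in> W \<Longrightarrow> l (\<lambda>x. c * f x) = c * l f"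
    and l_bound: "g \<in> W \<Longrightarrow> norm (l g) \<le> C * sobolev_norm 2 M lam phi b g"
    and l_real: "g \<in> W \<Longrightarrow> (\<And>x. g x \<in> \<real>) \<Longrightarrow> l g \<in> \<real>"
begin

definition representer :: "nat \<Rightarrow> complex" where "representer k = l (wphi k)"

lemma cnj_representer: "cnj (representer k) = representer k"
  using l_real[OF wphi_W[of k]] by (auto simp: representer_def wphi_def Reals_cnj_iff)

lemma l_sum:
  assumes "finite A" "\<And>i. i \<in> A \<Longrightarrow> g i \<in> W"
  shows "l (\<lambda>x. \<Sum>i\<in>A. a i * g i x) = (\<Sum>i\<in>A. a i * l (g i))"
  by (rule W_linear_sum[THEN conjunct2]) (simp_all add: l_add l_scale assms)

lemma wphi_sum:
  "(\<lambda>x. \<Sum>k<n. a k * wphi k x) \<in> W"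
  "l (\<lambda>x. \<Sum>k<n. a k * wphi k x) = (\<Sum>k<n. a k * representer k)"
  "wcoeff (\<lambda>x. \<Sum>k<n. a k * wphi k x) j = (if j < n then a j else 0)"
proof -
  show "(\<lambda>x. \<Sum>k<n. a k * wphi k x) \<in> W"
    by (rule W_sum(1)) (simp_all add: wphi_W)
  show "l (\<lambda>x. \<Sum>k<n. a k * wphi k x) = (\<Sum>k<n. a k * representer k)"
    unfolding representer_def by (rule l_sum) (simp_all add: wphi_W)
  show "wcoeff (\<lambda>x. \<Sum>k<n. a k * wphi k x) j = (if j < n then a j else 0)"
    by (subst W_sum(2)) (simp_all add: wphi_W wcoeff_wphi if_distrib sum.delta cong: if_cong)
qed

text \<open>Duality: tested on the truncated representer, \<open>l\<close> returns the partial
  square sum S while the norm is sqrt S, so S \<le> C sqrt S. Cancelling sqrt S bounds S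
  independently of n.\<close>

lemma sqsum_representer: "sqsum representer"
  unfolding sqsum_def
proof (rule summableI_nonneg_bounded[where x = "C\<^sup>2"])
  fix n
  define S where "S = (\<Sum>k<n. (norm (representer k))\<^sup>2)"
  define g where "g = (\<lambda>x. \<Sum>k<n. cnj (representer k) * wphi k x)"
  have S0: "0 \<le> S" by (simp add: S_def sum_nonneg)
  have g: "g \<in> W" unfolding g_def by (rule wphi_sum)
  have "l g = complex_of_real S"
    unfolding g_def wphi_sum S_def by (simp add: complex_norm_square mult.commute del: of_real_power)
  moreover have "(\<lambda>k. (norm (wcoeff g k))\<^sup>2) = (\<lambda>k. if k \<in> {..<n} then (norm (representer k))\<^sup>2 else 0)"
    by (auto simp: g_def wphi_sum)
  then have "sobolev_norm 2 M lam phi b g = sqrt S"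
    unfolding sobolev_norm_eq[OF g]
    using sums_If_finite_set[of "{..<n}" "\<lambda>k. (norm (representer k))\<^sup>2"] by (simp add: S_def sums_iff)
  ultimately have "S \<le> C * sqrt S" using l_bound[OF g] S0 by simp
  then have "sqrt S * sqrt S \<le> C * sqrt S" using S0 by simp
  then have "sqrt S \<le> C \<or> S = 0" using S0 by (simp only: mult_le_cancel_right) auto
  then have "sqrt S \<le> \<bar>C\<bar>" by auto
  then have "(sqrt S)\<^sup>2 \<le> \<bar>C\<bar>\<^sup>2" using S0 by (intro power_mono) auto
  then show "(\<Sum>k<n. (norm (representer k))\<^sup>2) \<le> C\<^sup>2" using S0 by (simp add: S_def)
qed auto

text \<open>Linearity settles finite truncations of \<open>g\<close>. The remainder has Sobolev norm
  equal to the square root of a tail of a convergent series, and boundedness of \<open>l\<close>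
  sends its value to 0.\<close>

lemma l_eq_ell2_inner:
  assumes g: "g \<in> W"
  shows "l g = ell2_inner (wcoeff g) representer"
proof -
  define F where "F = (\<lambda>k. (norm (wcoeff g k))\<^sup>2)"
  have F: "summable F" using g by (simp add: W_iff sqsum_def F_def)
  define s where "s = (\<lambda>n x. \<Sum>k<n. wcoeff g k * wphi k x)"
  have sW: "s n \<in> W" for n unfolding s_def by (rule wphi_sum)
  have bound: "norm (l g - (\<Sum>k<n. wcoeff g k * representer k)) \<le> C * sqrt (suminf F - (\<Sum>k<n. F k))" for n
  proof -
    define r where "r = (\<lambda>x. g x + (-1) * s n x)"
    have rW: "r \<in> W" unfolding r_def by (intro W_add g W_scale sW)
    have "l r = l g - (\<Sum>k<n. wcoeff g k * representer k)"
      unfolding r_def l_add[OF g W_scale[OF sW]] l_scale[OF sW] by (simp add: s_def wphi_sum)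
    moreover have "wcoeff r k = wcoeff g k + (-1) * (if k < n then wcoeff g k else 0)" for k
      unfolding r_def wcoeff_add[OF g W_scale[OF sW]] wcoeff_scale by (simp add: s_def wphi_sum)
    then have "(\<lambda>k. (norm (wcoeff r k))\<^sup>2) = (\<lambda>k. F k - (if k \<in> {..<n} then F k else 0))"
      by (auto simp: F_def)
    then have "(\<Sum>k. (norm (wcoeff r k))\<^sup>2) = suminf F - (\<Sum>k<n. F k)"
      using sums_diff[OF summable_sums[OF F] sums_If_finite_set[of "{..<n}" F]] by (simp add: sums_iff)
    ultimately show ?thesis using l_bound[OF rW] sobolev_norm_eq[OF rW] by simp
  qed
  have "(\<lambda>n. C * sqrt (suminf F - (\<Sum>k<n. F k))) \<longlonglongrightarrow> C * sqrt (suminf F - suminf F)"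
    by (intro tendsto_intros summable_LIMSEQ F)
  then have "(\<lambda>n. l g - (\<Sum>k<n. wcoeff g k * representer k)) \<longlonglongrightarrow> 0"
    by (intro Lim_null_comparison[OF always_eventually[OF allI[OF bound]]]) simp
  then have "(\<lambda>n. l g - (l g - (\<Sum>k<n. wcoeff g k * representer k))) \<longlonglongrightarrow> l g - 0"
    by (intro tendsto_intros)
  then have "(\<lambda>k. wcoeff g k * representer k) sums l g" by (simp add: sums_def)
  then show ?thesis by (simp add: ell2_inner_def cnj_representer sums_iff)
qed

text \<open>Pairing the coordinates \<open>wphi k x\<close> of the kernel with the representer gives
  a sum that, read as a function of x, is the synthesis of the representer.\<close>

lemma l_kernel: "l (\<lambda>u. complex_of_real (kernel_G lam phi b u x)) = synthesis representer x"
  unfolding kernel_eq_synthesis l_eq_ell2_inner[OF synthesis_W(1)[OF sqsum_wphi]]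
  by (simp add: synthesis_W(2)[OF sqsum_wphi] ell2_inner_def synthesis_def cnj_representer mult.commute)

end

theorem theorem2p1:
  fixes \<mu> :: "'a :: metric_space measure"
    and q \<beta> :: real
    and lam :: "nat \<Rightarrow> real"
    and phi :: "nat \<Rightarrow> 'a \<Rightarrow> real"
    and b :: "real \<Rightarrow> real"
    and R M :: nat
    and L :: "nat \<Rightarrow> ('a \<Rightarrow> complex) \<Rightarrow> 'a \<Rightarrow> complex"
    and y :: "nat \<Rightarrow> 'a"
    and f :: "nat \<Rightarrow> nat \<Rightarrow> complex"
  defines "W \<equiv> sobolev 2 \<mu> lam phi b"
  assumes space: "data_defined_space \<mu> q lam phi"
    and mask: "is_mask q \<beta> b" and beta: "\<beta> > q / 2"
    and "R \<ge> 1" and "M \<ge> 1"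
    and linear: "\<And>k. k \<in> {1..R} \<Longrightarrow> linear_operator_on \<mu> W (L k)"
    and bounded: "\<And>k l. k \<in> {1..R} \<Longrightarrow> l \<in> {1..M} \<Longrightarrow>
      bounded_evaluation W (sobolev_norm 2 \<mu> lam phi b) (L k) (y l)"
    and real: "\<And>k l. k \<in> {1..R} \<Longrightarrow> l \<in> {1..M} \<Longrightarrow> real_evaluation W (L k) (y l)"
    and dual: "\<exists>\<psi>. \<forall>k\<in>{1..R}. \<forall>j\<in>{1..M}. \<psi> k j \<in> W \<and>
      (\<forall>i\<in>{1..R}. \<forall>l\<in>{1..M}. L i (\<psi> k j) (y l) = (if i = k \<and> j = l then 1 else 0))"
  shows "\<exists>(a :: nat \<Rightarrow> nat \<Rightarrow> complex) P.
    P = (\<lambda>x. \<Sum>k=1..R. \<Sum>j=1..M.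
           a k j * L k (\<lambda>u. complex_of_real (kernel_G lam phi b u x)) (y j)) \<and>
    P \<in> W \<and>
    (\<forall>k\<in>{1..R}. \<forall>l\<in>{1..M}. L k P (y l) = f k l) \<and>
    (\<forall>g\<in>W. (\<forall>k\<in>{1..R}. \<forall>l\<in>{1..M}. L k g (y l) = f k l) \<longrightarrow>
       Lp_norm 2 \<mu> (b_derivative 2 \<mu> lam phi b P) \<le> Lp_norm 2 \<mu> (b_derivative 2 \<mu> lam phi b g))"
proof -
  interpret data_defined_space \<mu> q lam phi by (rule space)
  obtain B where B: "\<And>n x. (\<Sum>k<n. (b (lam k))\<^sup>2 * (phi k x)\<^sup>2) \<le> B"
    using mask_diagonal_bounded[OF mask beta] by blast
  interpret sobolev_space \<mu> q lam phi b B
    by unfold_locales (use mask_nonzero[OF mask] B in auto)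
  define I where "I = {1..R} \<times> {1..M}"
  have I: "finite I" by (simp add: I_def)
  define l where "l = (\<lambda>p g. L (fst p) g (y (snd p)))"
  have "\<exists>C. bounded_functional \<mu> q lam phi b B (l p) C" if "p \<in> I" for p
  proof -
    have p: "fst p \<in> {1..R}" "snd p \<in> {1..M}" using that by (auto simp: I_def)
    obtain C where C: "\<And>g. g \<in> W \<Longrightarrow> norm (l p g) \<le> C * sobolev_norm 2 \<mu> lam phi b g"
      using bounded[OF p] by (auto simp: bounded_evaluation_def l_def)
    have "bounded_functional \<mu> q lam phi b B (l p) C"
    proof (unfold_locales, fold W_def)
      show "l p (\<lambda>x. g x + h x) = l p g + l p h" if "g \<in> W" "h \<in> W" for g h
        using linear[OF p(1)] that unfolding linear_operator_on_def l_def by metis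
      show "l p (\<lambda>x. c * g x) = c * l p g" if "g \<in> W" for g c
        using linear[OF p(1)] that unfolding linear_operator_on_def l_def by metis
      show "norm (l p g) \<le> C * sobolev_norm 2 \<mu> lam phi b g" if "g \<in> W" for g
        using that by (rule C)
      show "l p g \<in> \<real>" if "g \<in> W" "\<And>x. g x \<in> \<real>" for g
        using real[OF p] that unfolding real_evaluation_def l_def by blast
    qed
    then show ?thesis by blast
  qed
  then obtain C where bf: "\<And>p. p \<in> I \<Longrightarrow> bounded_functional \<mu> q lam phi b B (l p) (C p)" by metis
  define \<gamma> where "\<gamma> = (\<lambda>p k. l p (wphi k))"
  have \<gamma>: "sqsum (\<gamma> p)" and rep: "\<And>g. g \<in> W \<Longrightarrow> l p g = ell2_inner (wcoeff g) (\<gamma> p)"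
    and ker: "\<And>x. l p (\<lambda>u. complex_of_real (kernel_G lam phi b u x)) = synthesis (\<gamma> p) x" if "p \<in> I" for p
  proof -
    interpret bounded_functional \<mu> q lam phi b B "l p" "C p" by (rule bf[OF that])
    have "representer = \<gamma> p" by (simp add: representer_def \<gamma>_def fun_eq_iff)
    then show "sqsum (\<gamma> p)" "\<And>g. g \<in> W \<Longrightarrow> l p g = ell2_inner (wcoeff g) (\<gamma> p)"
      "\<And>x. l p (\<lambda>u. complex_of_real (kernel_G lam phi b u x)) = synthesis (\<gamma> p) x"
      using sqsum_representer l_eq_ell2_inner l_kernel by (auto simp: W_def)
  qed
  obtain \<psi> where \<psi>: "\<And>p. p \<in> I \<Longrightarrow> \<psi> (fst p) (snd p) \<in> W"
    "\<And>p p'. p \<in> I \<Longrightarrow> p' \<in> I \<Longrightarrow> l p' (\<psi> (fst p) (snd p)) = (if p = p' then 1 else 0)"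
  proof -
    obtain \<psi> where \<psi>: "\<forall>k\<in>{1..R}. \<forall>j\<in>{1..M}. \<psi> k j \<in> W \<and>
        (\<forall>i\<in>{1..R}. \<forall>l\<in>{1..M}. L i (\<psi> k j) (y l) = (if i = k \<and> j = l then 1 else 0))"
      using dual by blast
    show thesis
    proof (rule that[of \<psi>])
      fix p assume p: "p \<in> I"
      then show "\<psi> (fst p) (snd p) \<in> W" using \<psi> unfolding I_def mem_Times_iff by blast
      fix p' assume "p' \<in> I"
      with p have "l p' (\<psi> (fst p) (snd p)) = (if fst p' = fst p \<and> snd p = snd p' then 1 else 0)"
        using \<psi> unfolding I_def mem_Times_iff l_def by blast
      then show "l p' (\<psi> (fst p) (snd p)) = (if p = p' then 1 else 0)"
        by (auto simp: prod_eq_iff)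
    qed
  qed
  \<comment> \<open>Duality of the \<psi> makes this combination satisfy every constraint; only
    \<open>g0\<close> is ever projected.\<close>
  define g0 where "g0 = (\<lambda>x. \<Sum>p\<in>I. f (fst p) (snd p) * \<psi> (fst p) (snd p) x)"
  have g0W: "g0 \<in> W" and g0: "\<And>p. p \<in> I \<Longrightarrow> l p g0 = f (fst p) (snd p)"
  proof -
    show "g0 \<in> W"
      unfolding g0_def W_def by (rule W_sum(1)[OF I \<psi>(1)[unfolded W_def]])
    fix p assume p: "p \<in> I"
    show "l p g0 = f (fst p) (snd p)"
    proof -
      interpret bounded_functional \<mu> q lam phi b B "l p" "C p" by (rule bf[OF p])
      have "l p g0 = (\<Sum>p'\<in>I. f (fst p') (snd p') * l p (\<psi> (fst p') (snd p')))"
        unfolding g0_def by (rule l_sum[OF I \<psi>(1)[unfolded W_def]])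
      also have "\<dots> = (\<Sum>p'\<in>I. if p' = p then f (fst p') (snd p') else 0)"
        using \<psi>(2)[OF _ p] by (intro sum.cong) auto
      finally show ?thesis using p I by simp
    qed
  qed
  have W_sq: "sqsum (wcoeff g)" if "g \<in> W" for g using that by (simp add: W_def W_iff)
  obtain a where a: "\<And>p. p \<in> I \<Longrightarrow> ell2_inner (\<lambda>k. wcoeff g0 k - (\<Sum>p\<in>I. a p * \<gamma> p k)) (\<gamma> p) = 0"
    using ell2_projection[of I \<gamma>, OF I \<gamma> W_sq[OF g0W]] by blast
  \<comment> \<open>Its coordinates are the projection of those of \<open>g0\<close> onto the span
    of the representers; the residual is orthogonal to each representer, so the constraint values
    survive.\<close>
  define P where "P = (\<lambda>x. \<Sum>p\<in>I. a p * synthesis (\<gamma> p) x)"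
  have PW: "P \<in> W"
    unfolding P_def W_def by (rule W_sum(1)[OF I synthesis_W(1)[OF \<gamma>]])
  have Pc: "wcoeff P = (\<lambda>k. \<Sum>p\<in>I. a p * \<gamma> p k)"
  proof
    fix k
    have "wcoeff P k = (\<Sum>p\<in>I. a p * wcoeff (synthesis (\<gamma> p)) k)"
      unfolding P_def by (rule W_sum(2)[OF I synthesis_W(1)[OF \<gamma>]])
    then show "wcoeff P k = (\<Sum>p\<in>I. a p * \<gamma> p k)" by (simp add: synthesis_W(2) \<gamma>)
  qed
  have Pl: "l p P = f (fst p) (snd p)" if p: "p \<in> I" for p
    using a[OF p] ell2_inner_diff[OF W_sq[OF g0W] W_sq[OF PW] \<gamma>[OF p]] rep[OF p g0W] rep[OF p PW] g0[OF p]
    by (simp add: Pc)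
  have Peq: "P = (\<lambda>x. \<Sum>k=1..R. \<Sum>j=1..M.
           a (k, j) * L k (\<lambda>u. complex_of_real (kernel_G lam phi b u x)) (y j))"
  proof
    fix x
    have "P x = (\<Sum>p\<in>I. a p * l p (\<lambda>u. complex_of_real (kernel_G lam phi b u x)))"
      unfolding P_def by (simp add: ker)
    then show "P x = (\<Sum>k=1..R. \<Sum>j=1..M.
           a (k, j) * L k (\<lambda>u. complex_of_real (kernel_G lam phi b u x)) (y j))"
      by (simp add: I_def l_def sum.cartesian_product case_prod_unfold)
  qed
  have min: "sobolev_norm 2 \<mu> lam phi b P \<le> sobolev_norm 2 \<mu> lam phi b g"
    if g: "g \<in> W" and gl: "\<And>p. p \<in> I \<Longrightarrow> l p g = f (fst p) (snd p)" for g
  proof -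
    have sq: "sqsum (\<lambda>k. wcoeff g k - wcoeff P k)" by (intro sqsum_diff W_sq g PW)
    \<comment> \<open>Any two feasible functions differ by an element orthogonal to all
      representers, so \<open>P\<close>, though built from \<open>g0\<close>, is the projection of
      every feasible \<open>g\<close>.\<close>
    have "ell2_inner (\<lambda>k. wcoeff g k - wcoeff P k) (\<gamma> p) = 0" if p: "p \<in> I" for p
      using ell2_inner_diff[OF W_sq[OF g] W_sq[OF PW] \<gamma>[OF p]] rep[OF p g] rep[OF p PW] gl[OF p] Pl[OF p]
      by simp
    then have "ell2_inner (\<lambda>k. wcoeff g k - wcoeff P k) (wcoeff P) = 0"
      using ell2_inner_sum_right[OF sq, of I \<gamma> a] \<gamma> unfolding Pc by simp
    then show ?thesis
      using ell2_norm_le_of_orthogonal[OF W_sq[OF g] W_sq[OF PW]] g PW by (simp add: sobolev_norm_eq W_def)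
  qed
  show ?thesis
    using Peq PW Pl min
    by (intro exI[of _ "\<lambda>k j. a (k, j)"] exI[of _ P]) (auto simp: I_def l_def sobolev_norm_def)
qed

end
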